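(* Let $\{S_n\}_{n\ge 0}$ be a transient nearest-neighbor random walk on a tree with countable vertex set $X$ (with arbitrary transition probabilities), starting at a fixed vertex $x_0$. Then $\overline{\mathcal{E}}=\overline{\sigma}(V)$; that is, the completion of the exchangeable $\sigma$-field $\mathcal{E}$ equals the completion of the $\sigma$-field generated by the occupation numbers $V=\{V(x)\}_{x\in X}$.
   Context: A tree is a connected graph without cycles. A nearest-neighbor random walk on a tree with vertex set $X$ is a (time-homogeneous) Markov chain on $X$ whose transition probability from $x$ to $y$ can be nonzero only if $x$ and $y$ are adjacent. A Markov chain is transient if almost surely it visits each state only finitely often. Let $P$ be the law of the trajectory $(S_0,S_1,\ldots)$ on $X^{\{0,1,2,\ldots\}}$ with the product $\sigma$-field. A (measurable) event $A$ in the space of trajectories is exchangeable if it is invariant under finite permutations, i.e., if $(S_0,S_1,\ldots)\in A$ implies $(S_{\pi(0)},\ldots,S_{\pi(n)},S_{n+1},S_{n+2},\ldots)\in A$ for every $n$ and every permutation $\pi$ of $\{0,\ldots,n\}$. The exchangeable $\sigma$-field $\mathcal{E}$ is the $\sigma$-field of all exchangeable events. The occupation numbers are $V(x):=\#\{n\ge 0 : S_n=x\}$ for $x\in X$, and $V:=\{V(x)\}_{x\in X}$. An overline denotes completion with respect to $P$: $\overline{\mathcal{E}}$ is the completion of $\mathcal{E}$ and $\overline{\sigma}(V)$ is the completion of $\sigma(V)$. *)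

theory Defs
  imports "HOL-Probability.Probability" "Graph_Theory.Graph_Theory"
begin

section \<open>Trees\<close>

text \<open>
  Undirected simple graphs, possibly infinite, are bidirected digraphs: every edge is
  represented by its two orientations.  The constants \<open>forest\<close> and \<open>tree\<close> of the library
  are not usable here: they exclude directed cycles of every positive length, and the
  traversal of a single edge back and forth is such a cycle (of length 2).  In a bidirected
  digraph (simple, without loops), the cycles of the underlying undirected graph are the
  directed cycles of length at least 3.
\<close>

definition undirected_tree :: "'a pair_pre_digraph \<Rightarrow> bool" where
  "undirected_tree G \<longleftrightarrow>
     pair_bidirected_digraph G \<and> Digraph_Component.connected (with_proj G) \<and>
     \<not> (\<exists>p. pre_digraph.cycle (with_proj G) p \<and> 3 \<le> length p)"


section \<open>Markov chains\<close>

text \<open>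
  Time-homogeneous Markov chain \<open>S\<close> with state space \<open>X\<close>, defined on the probability space
  \<open>M\<close>; \<open>pmf (K x) y\<close> is the transition probability from \<open>x\<close> to \<open>y\<close>.
\<close>

definition markov_chain ::
  "'w measure \<Rightarrow> 'a set \<Rightarrow> ('a \<Rightarrow> 'a pmf) \<Rightarrow> (nat \<Rightarrow> 'w \<Rightarrow> 'a) \<Rightarrow> bool" where
  "markov_chain M X K S \<longleftrightarrow>
     prob_space M \<and>
     (\<forall>x\<in>X. set_pmf (K x) \<subseteq> X) \<and>
     (\<forall>n. S n \<in> M \<rightarrow>\<^sub>M count_space X) \<and>
     (\<forall>n (x :: nat \<Rightarrow> 'a) y.
        \<P>(\<omega> in M. \<forall>i\<le>n. S i \<omega> = x i) > 0 \<longrightarrow>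
        \<P>(\<omega> in M. S (Suc n) \<omega> = y \<bar> \<forall>i\<le>n. S i \<omega> = x i) = pmf (K (x n)) y)"

definition nearest_neighbor :: "'a pair_pre_digraph \<Rightarrow> ('a \<Rightarrow> 'a pmf) \<Rightarrow> bool" where
  "nearest_neighbor G K \<longleftrightarrow>
     (\<forall>x\<in>pverts G. \<forall>y. pmf (K x) y \<noteq> 0 \<longrightarrow> (x, y) \<in> parcs G)"

definition transient :: "'w measure \<Rightarrow> 'a set \<Rightarrow> (nat \<Rightarrow> 'w \<Rightarrow> 'a) \<Rightarrow> bool" where
  "transient M X S \<longleftrightarrow> (AE \<omega> in M. \<forall>x\<in>X. finite {n. S n \<omega> = x})"


section \<open>Trajectories, exchangeable events and occupation numbers\<close>

definition trajectories :: "'a set \<Rightarrow> (nat \<Rightarrow> 'a) measure" where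
  "trajectories X = (\<Pi>\<^sub>M n\<in>UNIV. count_space X)"

definition trajectory_law ::
  "'w measure \<Rightarrow> 'a set \<Rightarrow> (nat \<Rightarrow> 'w \<Rightarrow> 'a) \<Rightarrow> (nat \<Rightarrow> 'a) measure" where
  "trajectory_law M X S = distr M (trajectories X) (\<lambda>\<omega> n. S n \<omega>)"

definition exchangeable_events :: "'a set \<Rightarrow> (nat \<Rightarrow> 'a) set set" where
  "exchangeable_events X =
     {A \<in> sets (trajectories X). \<forall>n \<pi>. \<pi> permutes {..n} \<longrightarrow> (\<forall>s\<in>A. s \<circ> \<pi> \<in> A)}"

definition occupation_numbers :: "'a set \<Rightarrow> (nat \<Rightarrow> 'a) \<Rightarrow> 'a \<Rightarrow> enat" where
  "occupation_numbers X s =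
     (\<lambda>x\<in>X. if finite {n. s n = x} then enat (card {n. s n = x}) else \<infinity>)"

definition occupation_events :: "'a set \<Rightarrow> (nat \<Rightarrow> 'a) set set" where
  "occupation_events X =
     sets (vimage_algebra (space (trajectories X)) (occupation_numbers X)
            (\<Pi>\<^sub>M x\<in>X. count_space UNIV))"

text \<open>
  Completion of a sub-\<open>\<sigma>\<close>-field \<open>F\<close> of \<open>P\<close> with respect to \<open>P\<close>: all \<open>P\<close>-negligible sets are
  adjoined to \<open>F\<close>.  This differs from completing the restriction of \<open>P\<close> to \<open>F\<close>, which would
  adjoin only subsets of the \<open>P\<close>-null sets that belong to \<open>F\<close> itself.
\<close>

definition completed_sets :: "'b measure \<Rightarrow> 'b set set \<Rightarrow> 'b set set" where
  "completed_sets P F = sigma_sets (space P) (F \<union> null_sets (completion P))"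

end

theory Submission
  imports Defs "HOL-Combinatorics.Permutations"
begin

text \<open>
  The idea is a zero-one law conditionally on the occupation numbers \<open>V\<close>.  Let \<open>B\<close> be the side
  of an edge \<open>(a, b)\<close> that contains the starting point, on the event that the walk finally leaves
  \<open>B\<close>.  Call the sequence of the visits to \<open>B\<close> the trace of the walk; it is a finite list in which
  every excursion outside \<open>B\<close> shows up as a repetition of \<open>a\<close>.  Because the graph is a tree, the
  occupation numbers on \<open>B\<close> determine how often every directed edge in \<open>B\<close> and the edge
  \<open>(a, b)\<close> are used.  Replacing the trace by another one with the same occupation numbers, while
  keeping the excursions, therefore changes neither the probability nor \<open>V\<close>, and it is a
  finite permutation of the trajectory.  Hence, given \<open>V\<close>, the trace is uniformly distributed on
  a finite set and independent of every exchangeable event \<open>A\<close>.  By transience every initial segment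
  of the trajectory is contained in such a trace, so \<open>A\<close> is conditionally independent of the
  whole trajectory, in particular of itself, given \<open>V\<close>.
\<close>

section \<open>Walks and edge cuts\<close>

text \<open>The edge between \<open>a\<close> and \<open>b\<close> is the only link between
  \<open>B\<close> and its complement. Together with the signs \<epsilon> below, this is all that
  the combinatorics of lists uses of the tree.\<close>

locale edge_cut =
  fixes E :: "'a rel" and B :: "'a set" and a b :: 'a
  assumes irrefl_E: "irrefl E"
    and tail_in: "a \<in> B" and head_notin: "b \<notin> B"
    and leave: "\<And>x y. (x, y) \<in> E \<Longrightarrow> x \<in> B \<Longrightarrow> y \<notin> B \<Longrightarrow> x = a \<and> y = b"
    and enter: "\<And>x y. (x, y) \<in> E \<Longrightarrow> x \<notin> B \<Longrightarrow> y \<in> B \<Longrightarrow> x = b \<and> y = a"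

abbreviation walk :: "'a rel \<Rightarrow> 'a list \<Rightarrow> bool" where
  "walk E \<equiv> successively (\<lambda>x y. (x, y) \<in> E)"

abbreviation steps :: "'a list \<Rightarrow> ('a \<times> 'a) list" where
  "steps w \<equiv> zip w (tl w)"

lemma set_steps_walk: "walk E w \<Longrightarrow> set (steps w) \<subseteq> E"
  by (induction w rule: induct_list012) auto

text \<open>Charge half of each visit to the step before it and half to the step after it. Steps
  inside \<open>B\<close> then cancel, every crossing in either direction leaves
  \<open>\<epsilon> a\<close>, and entries balance exits up to the end points, which give the two
  correction terms.\<close>

lemma (in edge_cut) crossings_eq:
  fixes \<epsilon> :: "'a \<Rightarrow> int"
  assumes sign: "\<And>x y. (x, y) \<in> E \<Longrightarrow> \<epsilon> x = - \<epsilon> y"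
    and "walk E w" "w \<noteq> []"
  shows "2 * (\<Sum>v\<leftarrow>filter (\<lambda>v. v \<in> B) w. \<epsilon> v) =
    2 * \<epsilon> a * int (count_list (steps w) (a, b))
    + (if last w \<in> B then \<epsilon> (last w) + \<epsilon> a else 0)
    + (if hd w \<in> B then \<epsilon> (hd w) - \<epsilon> a else 0)"
  using assms(2,3)
proof (induction w rule: induct_list012)
  case (3 x y w)
  then have xy: "(x, y) \<in> E" and "walk E (y # w)" by auto
  note IH = 3(2)[OF this(2)]
  show ?case
  proof (cases "x \<in> B"; cases "y \<in> B")
    assume "x \<in> B" "y \<in> B"
    then show ?thesis using IH sign[OF xy] head_notin by (auto simp: algebra_simps)
  next
    assume "x \<in> B" "y \<notin> B"
    then show ?thesis using IH leave[OF xy] by (auto simp: algebra_simps)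
  next
    assume "x \<notin> B" "y \<in> B"
    then have xy_eq: "x = b" "y = a" and "last (a # w) \<in> B \<or> last (a # w) \<notin> B"
      using enter[OF xy] by auto
    have "b \<noteq> a" using tail_in head_notin by auto
    with IH tail_in head_notin show ?thesis unfolding xy_eq by simp
  next
    assume "x \<notin> B" "y \<notin> B"
    moreover from this tail_in have "x \<noteq> a" by auto
    ultimately show ?thesis using IH by simp
  qed
qed auto

text \<open>Only the visits to \<open>B\<close> have to agree, so walks with unrelated excursions
  outside \<open>B\<close> can be compared.\<close>

lemma (in edge_cut) crossings_cong:
  fixes \<epsilon> :: "'a \<Rightarrow> int"
  assumes sign: "\<And>x y. (x, y) \<in> E \<Longrightarrow> \<epsilon> x = - \<epsilon> y" and nz: "\<And>x. \<epsilon> x \<noteq> 0"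
    and w: "walk E w" "w \<noteq> []" and w': "walk E w'" "w' \<noteq> []"
    and hd: "hd w = hd w'" and last: "last w = last w'"
    and mset: "mset (filter (\<lambda>v. v \<in> B) w) = mset (filter (\<lambda>v. v \<in> B) w')"
  shows "count_list (steps w) (a, b) = count_list (steps w') (a, b)"
proof -
  have "(\<Sum>v\<leftarrow>filter (\<lambda>v. v \<in> B) w. \<epsilon> v) = (\<Sum>v\<leftarrow>filter (\<lambda>v. v \<in> B) w'. \<epsilon> v)"
    using mset by (metis mset_map sum_mset_sum_list)
  then have "2 * \<epsilon> a * int (count_list (steps w) (a, b)) = 2 * \<epsilon> a * int (count_list (steps w') (a, b))"
    using crossings_eq[of \<epsilon>, OF sign w, unfolded hd last] crossings_eq[of \<epsilon>, OF sign w'] by linarith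
  then show ?thesis using nz[of a] by simp
qed

text \<open>Counted with alternating signs, the visits to one side of an edge reveal how often the
  edge is crossed; hence the occupation numbers of a walk between given end points determine
  all its steps.\<close>

lemma mset_steps_cong:
  fixes \<epsilon> :: "'a \<Rightarrow> int" and E :: "'a rel"
  assumes cut: "\<And>a b. (a, b) \<in> E \<Longrightarrow> \<exists>B. edge_cut E B a b"
    and sign: "\<And>x y. (x, y) \<in> E \<Longrightarrow> \<epsilon> x = - \<epsilon> y" and nz: "\<And>x. \<epsilon> x \<noteq> 0"
    and w: "walk E w" "w \<noteq> []" and w': "walk E w'" "w' \<noteq> []"
    and hd: "hd w = hd w'" and last: "last w = last w'" and mset: "mset w = mset w'"
  shows "mset (steps w) = mset (steps w')"
proof (rule multiset_eqI)
  fix e :: "'a \<times> 'a"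
  obtain a b where e: "e = (a, b)" by (cases e)
  show "count (mset (steps w)) e = count (mset (steps w')) e"
  proof (cases "(a, b) \<in> E")
    case True
    then obtain B where "edge_cut E B a b" using cut by blast
    then interpret edge_cut E B a b .
    show ?thesis
      using crossings_cong[of \<epsilon>, OF sign nz w w' hd last] by (simp add: e mset count_mset)
  next
    case False
    then have "e \<notin> set (steps w)" "e \<notin> set (steps w')"
      using set_steps_walk w w' e by blast+
    then show ?thesis by (metis count_mset_0_iff set_mset_mset not_in_iff)
  qed
qed

section \<open>Decomposition of a walk into its trace on \<open>B\<close> and its excursions\<close>

context edge_cut
begin

text \<open>The two visits to \<open>a\<close> that enclose an excursion are not part of it: they
  remain in the trace.\<close>

definition excursions :: "'a list set" where
  "excursions = {u. u \<noteq> [] \<and> walk E u \<and> hd u = b \<and> last u = b \<and> set u \<inter> B = {}}"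

text \<open>The lists in \<open>us\<close> are put, one after the other, between the repeated occurrences
  of \<open>a\<close> in \<open>t\<close>.\<close>

fun insert_excursions :: "'a list \<Rightarrow> 'a list list \<Rightarrow> 'a list" where
  "insert_excursions (x # y # t) us =
    (if x = a \<and> y = a then a # hd us @ insert_excursions (y # t) (tl us)
     else x # insert_excursions (y # t) us)"
| "insert_excursions t us = t"

definition trace :: "'a list \<Rightarrow> 'a list" where
  "trace w = filter (\<lambda>v. v \<in> B) w"

text \<open>\<open>E\<close> has no pair \<open>(a, a)\<close>, so in the trace of a walk such a
  step can only mark a removed excursion.\<close>

definition loops :: "'a list \<Rightarrow> nat" where
  "loops t = count_list (steps t) (a, a)"

lemma trace_simps [simp]:
  "trace [] = []" "trace (x # w) = (if x \<in> B then x # trace w else trace w)"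
  "trace (v @ w) = trace v @ trace w"
  by (auto simp: trace_def)

lemma loops_simps [simp]:
  "loops [] = 0" "loops [x] = 0"
  "loops (x # y # t) = (if x = a \<and> y = a then 1 else 0) + loops (y # t)"
  by (auto simp: loops_def)

lemma trace_excursion: "u \<in> excursions \<Longrightarrow> trace u = []"
  by (auto simp: excursions_def trace_def filter_empty_conv)

lemma not_loop: "(a, a) \<notin> E"
  using irrefl_E by (auto simp: irrefl_def)

text \<open>The candidates for the segment of a trajectory up to its last visit to \<open>B\<close>,
  which can only end at \<open>a\<close>.\<close>

definition walks :: "'a \<Rightarrow> 'a list \<Rightarrow> 'a list set" where
  "walks x t = {w. w \<noteq> [] \<and> walk E w \<and> hd w = x \<and> last w = a \<and> trace w = t}"

text \<open>The length supplies one excursion per repetition of \<open>a\<close>, so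
  \<open>insert_excursions\<close> never takes the \<open>hd\<close> of an empty list. The set
  depends on \<open>t\<close> through \<open>loops t\<close> alone.\<close>

definition excursion_lists :: "'a list \<Rightarrow> 'a list list set" where
  "excursion_lists t = {us. set us \<subseteq> excursions \<and> length us = loops t}"

text \<open>Cut at the first entry into \<open>B\<close>, necessarily the step from \<open>b\<close>
  to \<open>a\<close>.\<close>

lemma split_excursion:
  assumes "walk E (y # w)" "y \<notin> B" "last (y # w) \<in> B"
  shows "\<exists>u v. y # w = u @ a # v \<and> u \<noteq> [] \<and> last u = b \<and> set u \<inter> B = {}"
  using assms
proof (induction w arbitrary: y)
  case (Cons z w)
  show ?case
  proof (cases "z \<in> B")
    case True
    then have "y = b" "z = a" using enter[of y z] Cons.prems by auto
    then have "y # z # w = [y] @ a # w" "last [y] = b" "set [y] \<inter> B = {}"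
      using Cons.prems by auto
    then show ?thesis by blast
  next
    case False
    then obtain u v where u: "z # w = u @ a # v" "u \<noteq> []" "last u = b" "set u \<inter> B = {}"
      using Cons.IH[of z] Cons.prems by auto
    then have "y # z # w = (y # u) @ a # v" "last (y # u) = b" "set (y # u) \<inter> B = {}"
      using Cons.prems by auto
    then show ?thesis by blast
  qed
qed auto

text \<open>Strong induction on the length. A step out of \<open>B\<close> goes from
  \<open>a\<close> to \<open>b\<close>; as the walk ends in \<open>B\<close> it comes back to
  \<open>a\<close>, the stretch in between is an excursion, and the rest is shorter. The last
  conjunct ties the number of excursions to the crossings counted by
  \<open>crossings_eq\<close>.\<close>

lemma ex_excursions:
  assumes "walk E w" "w \<noteq> []" "hd w \<in> B" "last w \<in> B"
  shows "\<exists>us. set us \<subseteq> excursions \<and> length us = loops (trace w) \<and>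
    insert_excursions (trace w) us = w \<and> length us = count_list (steps w) (a, b)"
  using assms
proof (induction "length w" arbitrary: w rule: less_induct)
  case less
  obtain x w0 where w: "w = x # w0" and x: "x \<in> B" using less.prems by (cases w) auto
  show ?case
  proof (cases w0)
    case Nil
    then show ?thesis using w x by (intro exI[of _ "[]"]) auto
  next
    case (Cons y w1)
    have xy: "(x, y) \<in> E" and walk: "walk E (y # w1)" using less.prems w Cons by auto
    show ?thesis
    proof (cases "y \<in> B")
      case True
      with less.hyps[of "y # w1"] less.prems walk w Cons obtain us where
        us: "set us \<subseteq> excursions" "length us = loops (trace (y # w1))"
          "insert_excursions (trace (y # w1)) us = y # w1"
          "length us = count_list (steps (y # w1)) (a, b)"
        by auto
      have "\<not> (x = a \<and> y = a)" "\<not> (x = a \<and> y = b)" using xy not_loop True head_notin by auto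
      then show ?thesis using us x True by (intro exI[of _ us]) (auto simp: w Cons)
    next
      case False
      then have xa: "x = a" and yb: "y = b" using leave[OF xy x] by auto
      obtain u v where u: "y # w1 = u @ a # v" "u \<noteq> []" "last u = b" "set u \<inter> B = {}"
        using split_excursion[OF walk False] less.prems w Cons by auto
      have wu: "walk E u" "walk E (a # v)"
        using walk unfolding u(1) by (auto simp: successively_append_iff)
      have "hd u = b" using u(1,2) yb by (cases u) auto
      then have uex: "u \<in> excursions" using u wu by (auto simp: excursions_def)
      have "length (a # v) < length w" using u w Cons by (metis length_append length_Cons
            less_add_same_cancel2 less_SucI length_greater_0_conv)
      moreover have "last (a # v) = last w" using u w Cons
        by (metis last_appendR last_ConsR list.distinct(1))
      ultimately obtain us where
        us: "set us \<subseteq> excursions" "length us = loops (trace (a # v))"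
          "insert_excursions (trace (a # v)) us = a # v"
          "length us = count_list (steps (a # v)) (a, b)"
        using less.hyps[of "a # v"] less.prems wu tail_in by auto
      have weq: "w = a # u @ a # v" using u w Cons xa by simp
      have cnt: "count_list (steps (u' @ a # v)) (a, b) = count_list (steps (a # v)) (a, b)"
        if "a \<notin> set u'" for u'
        using that by (induction u' rule: induct_list012) auto
      have "a \<notin> set u" using u tail_in by auto
      then have "count_list (steps w) (a, b) = Suc (count_list (steps (a # v)) (a, b))"
        using cnt[of u] \<open>hd u = b\<close> u(2) by (cases u) (auto simp: weq)
      then show ?thesis
        using us uex tail_in trace_excursion[OF uex] by (intro exI[of _ "u # us"]) (auto simp: weq)
    qed
  qed
qed

text \<open>Removing an excursion brings two copies of \<open>a\<close> next to each other; this
  explains the extra pair \<open>(a, a)\<close>.\<close>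

lemma successively_trace:
  assumes "walk E w" "w \<noteq> []" "hd w \<in> B" "last w \<in> B"
  shows "walk (E \<union> {(a, a)}) (trace w)"
  using assms
proof (induction "length w" arbitrary: w rule: less_induct)
  case less
  obtain x w0 where w: "w = x # w0" and x: "x \<in> B" using less.prems by (cases w) auto
  show ?case
  proof (cases w0)
    case (Cons y w1)
    have xy: "(x, y) \<in> E" and walk: "walk E (y # w1)" using less.prems w Cons by auto
    show ?thesis
    proof (cases "y \<in> B")
      case True
      with less.hyps[of "y # w1"] less.prems walk w Cons x xy show ?thesis by auto
    next
      case False
      then have xa: "x = a" and yb: "y = b" using leave[OF xy x] by auto
      obtain u v where u: "y # w1 = u @ a # v" "u \<noteq> []" "last u = b" "set u \<inter> B = {}"
        using split_excursion[OF walk False] less.prems w Cons by auto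
      have wu: "walk E (a # v)"
        using walk unfolding u(1) by (auto simp: successively_append_iff)
      have "length (a # v) < length w" using u w Cons by (metis length_append length_Cons
            less_add_same_cancel2 less_SucI length_greater_0_conv)
      moreover have "last (a # v) = last w" using u w Cons
        by (metis last_appendR last_ConsR list.distinct(1))
      ultimately have "walk (E \<union> {(a, a)}) (trace (a # v))"
        using less.hyps[of "a # v"] less.prems wu tail_in by auto
      moreover have "trace w = a # trace (a # v)"
        using u w Cons xa tail_in by (auto simp: trace_def filter_empty_conv)
      ultimately show ?thesis using tail_in by auto
    qed
  qed (use w x in auto)
qed

lemma hd_trace: "w \<noteq> [] \<Longrightarrow> hd w \<in> B \<Longrightarrow> hd (trace w) = hd w"
  by (cases w) auto

lemma trace_neq_Nil: "w \<noteq> [] \<Longrightarrow> hd w \<in> B \<Longrightarrow> trace w \<noteq> []"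
  by (cases w) auto

lemma last_trace: "w \<noteq> [] \<Longrightarrow> last w \<in> B \<Longrightarrow> last (trace w) = last w"
  by (induction w rule: rev_induct) auto

lemma insert_excursions_Cons: "\<exists>w. insert_excursions (x # t) us = x # w"
  by (cases t) auto

text \<open>Converse of \<open>ex_excursions\<close>. Each excursion is reached by
  \<open>(a, b)\<close> and left by \<open>(b, a)\<close>, hence the two orientations of the
  edge.\<close>

lemma insert_excursions_walk:
  assumes "walk (E \<union> {(a, a)}) t" "set t \<subseteq> B" "t \<noteq> []" "us \<in> excursion_lists t" "last t = a"
    and edge: "(a, b) \<in> E" "(b, a) \<in> E"
  shows "insert_excursions t us \<in> walks (hd t) t"
  using assms(1-5)
proof (induction t us rule: insert_excursions.induct)
  case (1 x y t us)
  show ?case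
  proof (cases "x = a \<and> y = a")
    case True
    then obtain u us' where us: "us = u # us'" using 1 by (cases us) (auto simp: excursion_lists_def)
    have u: "u \<in> excursions" using 1 us by (auto simp: excursion_lists_def)
    then obtain u0 where u0: "u = b # u0" by (cases u) (auto simp: excursions_def)
    have "insert_excursions (a # t) us' \<in> walks a (a # t)"
      using 1 True us by (auto simp: excursion_lists_def)
    moreover obtain w where w: "insert_excursions (a # t) us' = a # w"
      using insert_excursions_Cons by blast
    moreover have "walk E (a # u @ a # w)"
      using calculation u edge
      by (auto simp: walks_def excursions_def successively_append_iff successively_Cons)
    ultimately show ?thesis
      using u True us tail_in trace_excursion[OF u]
      by (auto simp: walks_def excursions_def split: if_splits)
  next
    case False
    have "insert_excursions (y # t) us \<in> walks y (y # t)"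
      using 1 False by (auto simp: excursion_lists_def)
    moreover obtain w where w: "insert_excursions (y # t) us = y # w"
      using insert_excursions_Cons by blast
    moreover have "(x, y) \<in> E" using False 1(3) by auto
    ultimately show ?thesis
      using False 1(4) by (auto simp: walks_def split: if_splits)
  qed
qed (auto simp: walks_def excursion_lists_def)

text \<open>As \<open>a\<close> lies in \<open>B\<close>, the cut is recognisable as the first entry
  belonging to \<open>B\<close>.\<close>

lemma append_eq_outside:
  assumes "u @ a # v = u' @ a # v'" "set u \<inter> B = {}" "set u' \<inter> B = {}"
  shows "u = u' \<and> v = v'"
  using assms
proof (induction u arbitrary: u')
  case Nil
  then show ?case using tail_in by (cases u') auto
next
  case (Cons x u)
  then show ?case using tail_in by (cases u') auto
qed

lemma inj_insert_excursions: "inj_on (insert_excursions t) (excursion_lists t)"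
proof (rule inj_onI)
  fix us us'
  assume "us \<in> excursion_lists t" "us' \<in> excursion_lists t" "insert_excursions t us = insert_excursions t us'"
  then show "us = us'"
  proof (induction t us arbitrary: us' rule: insert_excursions.induct)
    case (1 x y t us)
    show ?case
    proof (cases "x = a \<and> y = a")
      case True
      obtain u us0 where us: "us = u # us0" using 1 True by (cases us) (auto simp: excursion_lists_def)
      obtain u' us0' where us': "us' = u' # us0'" using 1 True by (cases us') (auto simp: excursion_lists_def)
      obtain w where w: "insert_excursions (a # t) us0 = a # w"
        using insert_excursions_Cons by blast
      obtain w' where w': "insert_excursions (a # t) us0' = a # w'"
        using insert_excursions_Cons by blast
      have "u @ a # w = u' @ a # w'" using 1 True w w' us us' by auto
      moreover have "set u \<inter> B = {}" "set u' \<inter> B = {}"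
        using 1 us us' by (auto simp: excursion_lists_def excursions_def)
      ultimately have "u = u' \<and> w = w'" by (rule append_eq_outside)
      then show ?thesis using 1(1)[of us0'] 1 True us us' w w' by (auto simp: excursion_lists_def)
    next
      case False
      then show ?thesis using 1(2)[of us'] 1(3-) by (auto simp: excursion_lists_def)
    qed
  qed (auto simp: excursion_lists_def)
qed

text \<open>The walk \<open>w0\<close> guarantees that \<open>t\<close> is a possible trace. A walk
  then amounts to its trace and a free choice of excursions, and this freedom is what lets the trace
  be exchanged while the excursions stay.\<close>

lemma bij_betw_walks:
  assumes "w0 \<in> walks x t" "x \<in> B" and edge: "(a, b) \<in> E" "(b, a) \<in> E"
  shows "bij_betw (insert_excursions t) (excursion_lists t) (walks x t)"
proof -
  have t: "walk (E \<union> {(a, a)}) t" "set t \<subseteq> B" "t \<noteq> []" "last t = a" "hd t = x"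
    using assms successively_trace[of w0] hd_trace[of w0] last_trace[of w0] trace_neq_Nil[of w0] tail_in
    by (auto simp: walks_def trace_def)
  have "w \<in> insert_excursions t ` excursion_lists t" if "w \<in> walks x t" for w
    using ex_excursions[of w] that assms(2) tail_in by (auto simp: walks_def excursion_lists_def)
  moreover have "insert_excursions t us \<in> walks x t" if "us \<in> excursion_lists t" for us
    using insert_excursions_walk[OF t(1-3) that t(4) edge] t(5) by simp
  ultimately show ?thesis
    using inj_insert_excursions by (auto simp: bij_betw_def)
qed

lemma mset_insert_excursions:
  assumes "us \<in> excursion_lists t"
  shows "mset (insert_excursions t us) = mset t + mset (concat us)"
  using assms
proof (induction t us rule: insert_excursions.induct)
  case (1 x y t us)
  show ?case
  proof (cases "x = a \<and> y = a")
    case True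
    then obtain u us' where us: "us = u # us'" using 1 by (cases us) (auto simp: excursion_lists_def)
    then show ?thesis using 1 True by (auto simp: excursion_lists_def)
  next
    case False
    then show ?thesis using 1 by (auto simp: excursion_lists_def)
  qed
qed (auto simp: excursion_lists_def)

text \<open>An excursion that starts within \<open>c\<close> would show up in the trace as a
  repeated \<open>a\<close>, which a genuine walk \<open>c\<close> cannot contain. Hence the trace
  follows the walk until \<open>c\<close> is complete.\<close>

lemma prefix_trace:
  assumes "walk E w" "w \<noteq> []" "hd w \<in> B" "last w \<in> B" "walk E c" "c \<noteq> []" "trace w = c @ r"
  shows "\<exists>r'. w = c @ r'"
  using assms
proof (induction c arbitrary: w)
  case (Cons x c)
  then obtain w1 where w: "w = x # w1" by (cases w) auto
  show ?case
  proof (cases c)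
    case Nil
    then show ?thesis using w by auto
  next
    case c: (Cons z c')
    with Cons.prems obtain y w2 where w1: "w1 = y # w2" using w by (cases w1) auto
    have "y \<in> B"
    proof (rule ccontr)
      assume "y \<notin> B"
      have "x = a" using leave[of x y] Cons.prems w w1 \<open>y \<notin> B\<close> by auto
      obtain u v where u: "y # w2 = u @ a # v" "set u \<inter> B = {}"
        using split_excursion[OF _ \<open>y \<notin> B\<close>, of w2] Cons.prems w w1 by auto
      then have "trace w1 = a # trace v"
        using tail_in by (auto simp: w1 trace_def filter_empty_conv simp del: filter.simps(2))
           (auto simp: filter_empty_conv)
      then have "z = a" using Cons.prems w c by auto
      then show False using \<open>x = a\<close> Cons.prems c not_loop by auto
    qed
    then have "\<exists>r'. w1 = c @ r'"
      using Cons.prems w w1 c by (intro Cons.IH) auto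
    then show ?thesis using w by auto
  qed
qed auto

end

section \<open>Trees\<close>

text \<open>The connected component of \<open>a\<close> once the edge between \<open>a\<close> and
  \<open>b\<close> is deleted.\<close>

definition side :: "'a rel \<Rightarrow> 'a \<Rightarrow> 'a \<Rightarrow> 'a set" where
  "side E a b = (E - {(a, b), (b, a)})\<^sup>* `` {a}"

text \<open>An edge out of the component other than the deleted one would enlarge it;
  \<open>b \<notin> side E a b\<close> then settles the direction in which the deleted edge is
  crossed.\<close>

lemma edge_cut_side:
  assumes "sym E" "irrefl E" "b \<notin> side E a b"
  shows "edge_cut E (side E a b) a b"
proof
  fix x y assume xy: "(x, y) \<in> E"
  { assume "x \<in> side E a b" "y \<notin> side E a b"
    then have "(x, y) \<notin> E - {(a, b), (b, a)}"
      by (auto simp: side_def intro: rtrancl_into_rtrancl)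
    with xy \<open>x \<in> side E a b\<close> assms(3) show "x = a \<and> y = b" by auto }
  { assume "x \<notin> side E a b" "y \<in> side E a b"
    then have "(y, x) \<notin> E - {(a, b), (b, a)}"
      by (auto simp: side_def intro: rtrancl_into_rtrancl)
    with xy \<open>y \<in> side E a b\<close> assms(1,3) show "x = b \<and> y = a" by (auto dest: symD) }
qed (use assms in \<open>auto simp: side_def\<close>)

lemma side_subset: "E \<subseteq> X \<times> X \<Longrightarrow> a \<in> X \<Longrightarrow> side E a b \<subseteq> X"
proof
  fix x assume "E \<subseteq> X \<times> X" "a \<in> X" "x \<in> side E a b"
  then have "(a, x) \<in> (E - {(a, b), (b, a)})\<^sup>*" by (auto simp: side_def)
  then show "x \<in> X" using \<open>a \<in> X\<close> \<open>E \<subseteq> X \<times> X\<close> by (induction) auto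
qed

text \<open>Vertices are coloured by the parity of the distance to \<open>x\<close>.  Two adjacent vertices at
  the same distance would be joined by two geodesics that avoid their common edge.\<close>

lemma ex_sign:
  assumes sym: "sym E" and conn: "\<And>y z. (y, z) \<in> E \<Longrightarrow> (x, y) \<in> E\<^sup>*"
    and side: "\<And>a b. (a, b) \<in> E \<Longrightarrow> b \<notin> side E a b"
  shows "\<exists>\<epsilon> :: 'a \<Rightarrow> int. (\<forall>(y, z)\<in>E. \<epsilon> y = - \<epsilon> z) \<and> (\<forall>y. \<epsilon> y \<noteq> 0)"
proof -
  define d where "d y = (LEAST n. (x, y) \<in> E ^^ n)" for y
  have d: "(x, y) \<in> E ^^ d y" if "(x, y) \<in> E\<^sup>*" for y
    unfolding d_def using rtrancl_imp_relpow[OF that] by (rule LeastI_ex)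
  have d_le: "d y \<le> n" if "(x, y) \<in> E ^^ n" for y n
    unfolding d_def using that by (rule Least_le)
  have step: "d z \<le> Suc (d y)" if "(y, z) \<in> E" for y z
    by (rule d_le, rule relpow_Suc_I[OF d[OF conn[OF that]] that])
  define D where "D = {(p, q) \<in> E. d q = Suc (d p)}"
  have geodesic: "(x, y) \<in> D\<^sup>*" if "(x, y) \<in> E\<^sup>*" "d y = n" for y n
    using that
  proof (induction n arbitrary: y)
    case 0
    then have "(x, y) \<in> E ^^ 0" using d by metis
    then have "y = x" by simp
    then show ?case by simp
  next
    case (Suc n)
    then have "(x, y) \<in> E ^^ Suc n" using d by metis
    then obtain p where p: "(x, p) \<in> E ^^ n" "(p, y) \<in> E" by (rule relpow_Suc_E)
    then have "d p = n" using d_le[OF p(1)] step[OF p(2)] Suc.prems by linarith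
    then have "(p, y) \<in> D" using Suc.prems p by (simp add: D_def)
    moreover have "(x, p) \<in> D\<^sup>*" using Suc.IH[OF conn[OF p(2)] \<open>d p = n\<close>] .
    ultimately show ?case by (rule rtrancl_into_rtrancl[rotated])
  qed
  have neq: "d y \<noteq> d z" if yz: "(y, z) \<in> E" for y z
  proof
    assume eq: "d y = d z"
    have zy: "(z, y) \<in> E" using sym yz by (auto dest: symD)
    have sub: "D \<subseteq> E - {(y, z), (z, y)}" using eq by (auto simp: D_def)
    have "(x, y) \<in> (E - {(y, z), (z, y)})\<^sup>*" "(x, z) \<in> (E - {(y, z), (z, y)})\<^sup>*"
      using geodesic conn yz zy rtrancl_mono[OF sub] by blast+
    moreover have "sym (E - {(y, z), (z, y)})" using sym by (auto simp: sym_def)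
    ultimately have "(y, z) \<in> (E - {(y, z), (z, y)})\<^sup>*"
      by (meson sym_rtrancl symD rtrancl_trans)
    then show False using side[OF yz] by (auto simp: side_def)
  qed
  have "d y = Suc (d z) \<or> d z = Suc (d y)" if "(y, z) \<in> E" for y z
    using neq[OF that] step[OF that] step[OF symD[OF sym that]] by linarith
  then have "(-1 :: int) ^ d y = - ((-1) ^ d z)" if "(y, z) \<in> E" for y z
    using that by fastforce
  then show ?thesis by (intro exI[of _ "\<lambda>y. (-1) ^ d y"]) auto
qed

text \<open>Otherwise a path from \<open>a\<close> to \<open>b\<close> avoids the edge, and closing
  it with \<open>(b, a)\<close> yields a cycle. Its length is at least 3: the path is not empty
  because \<open>a \<noteq> b\<close>, and not a single arc because \<open>(a, b)\<close> was
  deleted.\<close>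

lemma tree_side:
  assumes tree: "undirected_tree G" and ab: "(a, b) \<in> parcs G"
  shows "b \<notin> side (parcs G) a b"
proof
  assume "b \<in> side (parcs G) a b"
  define E where "E = parcs G - {(a, b), (b, a)}"
  define H where "H = \<lparr>pverts = pverts G, parcs = E\<rparr>"
  interpret G: pair_bidirected_digraph G
    using tree by (simp add: undirected_tree_def)
  interpret H: pair_wf_digraph H
    by standard (auto simp: H_def E_def dest: G.in_arcsD1 G.in_arcsD2)
  have H: "pverts H = pverts G" "parcs H = E" by (simp_all add: H_def)
  have "(a, b) \<in> E\<^sup>*" using \<open>b \<in> _\<close> by (simp add: side_def E_def)
  moreover have "a \<in> pverts G" using ab G.in_arcsD1 by auto
  ultimately have "\<exists>p. H.awalk a p b"
  proof (induction rule: converse_rtrancl_induct)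
    case base
    then show ?case by (intro exI[of _ "[]"]) (auto simp: H.awalk_Nil_iff H G.in_arcsD2[OF ab])
  next
    case (step y z)
    then have "z \<in> pverts G" using G.in_arcsD2 by (auto simp: E_def)
    with step obtain p where "H.awalk z p b" by auto
    then show ?case using step by (intro exI[of _ "(y, z) # p"]) (auto simp: H.awalk_Cons_iff H)
  qed
  \<comment> \<open>Shortening the walk inside \<open>H\<close> makes its vertices distinct without
    bringing the deleted edge back.\<close>
  then obtain p where "H.apath a p b" using H.apath_awalk_to_apath by blast
  then have p: "H.awalk a p b" "distinct (pawalk_verts a p)"
    by (auto simp: H.apath_def)
  then have Gp: "G.awalk a p b" by (auto simp: H.awalk_def G.awalk_def H E_def)
  have ba: "(b, a) \<in> parcs G" using ab G.arcs_symmetric by blast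
  have "pawalk_verts c (q @ [(b, a)]) = pawalk_verts c q @ [a]" if "G.awalk c q b" for c q
    using that by (induction q arbitrary: c) (auto simp: G.awalk_Cons_iff G.awalk_Nil_iff)
  then have verts: "pawalk_verts a (p @ [(b, a)]) = pawalk_verts a p @ [a]"
    using Gp .
  have "G.awalk a (p @ [(b, a)]) a"
  proof (rule G.awalk_appendI[OF Gp])
    show "G.awalk b [(b, a)] a"
      using ba G.in_arcsD2[OF ba] by (simp add: G.awalk_Cons_iff G.awalk_Nil_iff)
  qed
  moreover have "distinct (tl (pawalk_verts a (p @ [(b, a)])))"
    unfolding verts using p(2) Gp by (cases p) (auto simp: G.awalk_Cons_iff)
  ultimately have "G.cycle (p @ [(b, a)])" by (subst G.cycle_def) (use G.awalk_def in blast)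
  moreover have "3 \<le> length (p @ [(b, a)])"
  proof -
    have "a \<noteq> b" using G.pair_no_loops[OF ab] by auto
    then have "p \<noteq> []" using Gp by (auto simp: G.awalk_Nil_iff)
    moreover have "p \<noteq> [e]" for e
      using p(1) by (auto simp: H.awalk_def H E_def)
    ultimately show ?thesis by (cases p; cases "tl p") auto
  qed
  ultimately show False using tree by (auto simp: undirected_tree_def)
qed

text \<open>\<open>Digraph_Component.connected\<close> ignores orientation; symmetry of the arcs
  turns it into reachability along arcs.\<close>

lemma tree_connected:
  assumes tree: "undirected_tree G" and "x \<in> pverts G" "y \<in> pverts G"
  shows "(x, y) \<in> (parcs G)\<^sup>*"
proof -
  interpret G: pair_bidirected_digraph G
    using tree by (simp add: undirected_tree_def)
  have "Digraph_Component.connected (with_proj G)" using tree by (simp add: undirected_tree_def)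
  then have "strongly_connected (with_proj G)"
    by (rule G.symmetric_connected_imp_strongly_connected[OF G.sym_arcs])
  then have "x \<rightarrow>\<^sup>*\<^bsub>with_proj G\<^esub> y" using assms by (auto simp: strongly_connected_def)
  then have "(x, y) \<in> (arcs_ends (with_proj G))\<^sup>*" by (rule reachable_rtranclI)
  then show ?thesis by simp
qed

section \<open>Trajectories\<close>

lemma space_trajectories: "space (trajectories X) = {s. \<forall>n. s n \<in> X}"
  by (auto simp: trajectories_def space_PiM PiE_def)

lemma measurable_nth_trajectories [measurable]:
  "(\<lambda>s. s n) \<in> trajectories X \<rightarrow>\<^sub>M count_space X"
  unfolding trajectories_def by (rule measurable_component_singleton) simp

lemma pred_trajectories_mem [measurable]: "Measurable.pred (trajectories X) (\<lambda>s. s n \<in> A)"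
proof -
  have "{s \<in> space (trajectories X). s n \<in> A} = (\<lambda>s. s n) -` (A \<inter> X) \<inter> space (trajectories X)"
    by (auto simp: space_trajectories)
  also have "\<dots> \<in> sets (trajectories X)"
    by (rule measurable_sets[OF measurable_nth_trajectories]) simp
  finally show ?thesis by (simp add: pred_def)
qed

lemma pred_trajectories_eq [measurable]: "Measurable.pred (trajectories X) (\<lambda>s. s n = x)"
  using pred_trajectories_mem[of n "{x}" X] by simp

section \<open>Cylinders as generators of the trajectory sigma-field\<close>

definition cylinder :: "'a set \<Rightarrow> 'a list \<Rightarrow> (nat \<Rightarrow> 'a) set" where
  "cylinder X w = {s \<in> space (trajectories X). \<forall>i<length w. s i = w ! i}"

lemma cylinder_sets [measurable]: "cylinder X w \<in> sets (trajectories X)"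
  unfolding cylinder_def by measurable

lemma cylinder_Nil: "cylinder X [] = space (trajectories X)"
  by (simp add: cylinder_def)

lemma cylinder_Int:
  assumes "length v \<le> length w"
  shows "cylinder X v \<inter> cylinder X w = (if take (length v) w = v then cylinder X w else {})"
proof (cases "take (length v) w = v")
  case True
  then have "v ! i = w ! i" if "i < length v" for i using that by (metis nth_take)
  then show ?thesis using True assms by (auto simp: cylinder_def)
next
  case False
  then obtain i where "i < length v" "v ! i \<noteq> w ! i"
    using assms by (auto simp: list_eq_iff_nth_eq)
  then show ?thesis using False assms by (fastforce simp: cylinder_def)
qed

text \<open>Two cylinders are nested or disjoint; the empty set is adjoined for the second
  case.\<close>

lemma Int_stable_cylinders: "Int_stable (insert {} (cylinder X ` lists X))"
proof -
  have "cylinder X v \<inter> cylinder X w \<in> insert {} (cylinder X ` lists X)"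
    if "v \<in> lists X" "w \<in> lists X" for v w
    using that cylinder_Int[of v w X] cylinder_Int[of w v X]
    by (cases "length v \<le> length w") (auto simp: Int_commute)
  then show ?thesis by (auto simp: Int_stable_def)
qed

text \<open>A condition on coordinate \<open>n\<close> is a union of cylinders over lists of length
  \<open>Suc n\<close>, and there are only countably many of them.\<close>

lemma sets_trajectories:
  assumes "countable X"
  shows "sets (trajectories X) =
    sigma_sets (space (trajectories X)) (insert {} (cylinder X ` lists X))"
proof (rule antisym)
  let ?S = "sigma_sets (space (trajectories X)) (insert {} (cylinder X ` lists X))"
  show "?S \<subseteq> sets (trajectories X)"
    by (rule sets.sigma_sets_subset) auto
  have "{s \<in> space (trajectories X). s n \<in> A} \<in> ?S" if "A \<subseteq> X" for n A
  proof -
    let ?W = "{w \<in> lists X. length w = Suc n \<and> w ! n \<in> A}"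
    have "{s \<in> space (trajectories X). s n \<in> A} = (\<Union>w\<in>?W. cylinder X w)"
    proof (intro equalityI subsetI)
      fix s assume "s \<in> {s \<in> space (trajectories X). s n \<in> A}"
      then have s: "s n \<in> A" "\<And>i. s i \<in> X" "s \<in> space (trajectories X)"
        by (auto simp: space_trajectories)
      define w where "w = map s [0..<Suc n]"
      have "length w = Suc n" "\<And>i. i < Suc n \<Longrightarrow> w ! i = s i" "w \<in> lists X"
        unfolding w_def using s(2) by (auto simp del: upt_Suc)
      then show "s \<in> (\<Union>w\<in>?W. cylinder X w)"
        using s by (intro UN_I[of w]) (auto simp: cylinder_def)
    qed (auto simp: cylinder_def)
    moreover have "countable ?W"
      by (rule countable_subset[OF _ countable_lists[OF assms]]) auto
    moreover have "cylinder X w \<in> ?S" if "w \<in> lists X" for w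
      using that by (intro sigma_sets.Basic) auto
    ultimately show ?thesis by (simp only:) (rule sigma_sets_UNION, auto)
  qed
  then have "sigma_sets (space (trajectories X))
      {{s \<in> space (trajectories X). s n \<in> A} |n A. A \<subseteq> X} \<subseteq> ?S"
    by (intro sigma_sets_mono) blast
  moreover have "sets (trajectories X) = sigma_sets (space (trajectories X))
      {{s \<in> space (trajectories X). s n \<in> A} |n A. A \<subseteq> X}"
    unfolding trajectories_def sets_PiM_single by (simp add: space_PiM)
  ultimately show "sets (trajectories X) \<subseteq> ?S" by simp
qed

lemma trajectories_measure_eqI:
  assumes "countable X" "sets M1 = sets (trajectories X)" "sets M2 = sets (trajectories X)"
    and "\<And>w. w \<in> lists X \<Longrightarrow> emeasure M1 (cylinder X w) = emeasure M2 (cylinder X w)"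
    and "emeasure M1 (space (trajectories X)) \<noteq> \<infinity>"
  shows "M1 = M2"
proof (rule measure_eqI_generator_eq[OF Int_stable_cylinders])
  show "insert {} (cylinder X ` lists X) \<subseteq> Pow (space (trajectories X))"
    by (auto simp: cylinder_def)
  show "range (\<lambda>_::nat. space (trajectories X)) \<subseteq> insert {} (cylinder X ` lists X)"
    using cylinder_Nil[of X] by force
qed (use assms sets_trajectories[of X] in auto)

section \<open>Occupation numbers and invariance under finite permutations\<close>

lemma vimage_permutes:
  assumes "\<pi> permutes A"
  shows "finite (\<pi> -` S) \<longleftrightarrow> finite S" "card (\<pi> -` S) = card S"
  using permutes_bij[OF assms]
  by (auto simp: bij_def finite_vimage_iff card_vimage_inj)

lemma occupation_numbers_permutes:
  assumes "\<pi> permutes A"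
  shows "occupation_numbers X (s \<circ> \<pi>) = occupation_numbers X s"
proof -
  have "finite {n. s (\<pi> n) = x} \<longleftrightarrow> finite {n. s n = x}"
    "card {n. s (\<pi> n) = x} = card {n. s n = x}" for x
    using vimage_permutes[OF assms, of "{n. s n = x}"] by simp_all
  then show ?thesis unfolding occupation_numbers_def by (simp cong: if_cong)
qed

lemma measurable_occupation_numbers [measurable]:
  "occupation_numbers X \<in> trajectories X \<rightarrow>\<^sub>M (\<Pi>\<^sub>M x\<in>X. count_space UNIV)"
  unfolding occupation_numbers_def
proof (rule measurable_restrict)
  fix x assume "x \<in> X"
  let ?f = "\<lambda>s :: nat \<Rightarrow> _. if finite {n. s n = x} then enat (card {n. s n = x}) else \<infinity>"
  have "{s \<in> space (trajectories X). ?f s = k} \<in> sets (trajectories X)" for k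
  proof (cases k)
    case (enat m)
    \<comment> \<open>The visit times are listed, because lists of naturals are countable and the
      existential becomes a countable union.\<close>
    have "?f s = k \<longleftrightarrow> (\<exists>l::nat list. distinct l \<and> length l = m \<and> (\<forall>n. s n = x \<longleftrightarrow> n \<in> set l))" for s
    proof
      assume "?f s = k"
      then have "finite {n. s n = x}" "card {n. s n = x} = m" by (auto simp: enat split: if_splits)
      moreover from this(1) obtain l where "set l = {n. s n = x}" "distinct l"
        using finite_distinct_list by blast
      ultimately show "\<exists>l::nat list. distinct l \<and> length l = m \<and> (\<forall>n. s n = x \<longleftrightarrow> n \<in> set l)"
        by (metis distinct_card mem_Collect_eq)
    next
      assume "\<exists>l::nat list. distinct l \<and> length l = m \<and> (\<forall>n. s n = x \<longleftrightarrow> n \<in> set l)"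
      then obtain l where l: "distinct l" "length l = m" "{n. s n = x} = set l" by auto
      show "?f s = k" unfolding l(3) using l distinct_card by (auto simp: enat)
    qed
    then show ?thesis by simp
  next
    case infinity
    have "?f s = k \<longleftrightarrow> infinite {n. s n = x}" for s
      by (simp add: infinity)
    then have "?f s = k \<longleftrightarrow> (\<forall>m. \<exists>n\<ge>m. s n = x)" for s
      unfolding infinite_nat_iff_unbounded_le by simp
    then show ?thesis by simp
  qed
  then show "?f \<in> trajectories X \<rightarrow>\<^sub>M count_space UNIV"
    by (intro measurable_count_space_eq_countable[THEN iffD2])
      (auto simp: vimage_def Int_def conj_commute)
qed

lemma occupation_numbers_funcset:
  "occupation_numbers X \<in> space (trajectories X) \<rightarrow> space (\<Pi>\<^sub>M x\<in>X. count_space UNIV)"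
  by (rule Pi_I) (rule measurable_space[OF measurable_occupation_numbers])

text \<open>\<open>occupation_events\<close> as a measure, so that measurability and conditional
  expectation with respect to it make sense.\<close>

definition occupation_algebra :: "'a set \<Rightarrow> (nat \<Rightarrow> 'a) measure" where
  "occupation_algebra X = vimage_algebra (space (trajectories X)) (occupation_numbers X)
     (\<Pi>\<^sub>M x\<in>X. count_space UNIV)"

lemma sets_occupation_algebra: "sets (occupation_algebra X) = occupation_events X"
  by (simp add: occupation_algebra_def occupation_events_def)

lemma space_occupation_algebra: "space (occupation_algebra X) = space (trajectories X)"
  by (simp add: occupation_algebra_def)

lemma occupation_events_subset: "occupation_events X \<subseteq> exchangeable_events X"
proof
  fix A assume "A \<in> occupation_events X"
  then obtain B where B: "B \<in> sets (\<Pi>\<^sub>M x\<in>X. count_space UNIV)"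
    "A = occupation_numbers X -` B \<inter> space (trajectories X)"
    unfolding occupation_events_def by (auto simp: sets_vimage_algebra2[OF occupation_numbers_funcset])
  then have "A \<in> sets (trajectories X)"
    using measurable_sets[OF measurable_occupation_numbers] by blast
  moreover have "s \<circ> \<pi> \<in> A" if "s \<in> A" "\<pi> permutes {..n}" for s \<pi> and n :: nat
    using that B occupation_numbers_permutes[of \<pi> _ X s] by (auto simp: space_trajectories)
  ultimately show "A \<in> exchangeable_events X" by (auto simp: exchangeable_events_def)
qed

text \<open>Functions rather than events, since an indicator and a conditional expectation are both
  going to be used as densities.\<close>

definition exchangeable :: "'a set \<Rightarrow> ((nat \<Rightarrow> 'a) \<Rightarrow> 'b) \<Rightarrow> bool" where
  "exchangeable X h \<longleftrightarrow> (\<forall>n \<pi>. \<forall>s\<in>space (trajectories X). \<pi> permutes {..n::nat} \<longrightarrow> h (s \<circ> \<pi>) = h s)"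

text \<open>Invariance of an event is defined by one implication; the inverse permutation provides
  the other.\<close>

lemma exchangeable_indicator:
  assumes "A \<in> exchangeable_events X"
  shows "exchangeable X (indicator A :: _ \<Rightarrow> ennreal)"
proof -
  have *: "s \<circ> \<pi> \<in> A" if "s \<in> A" "\<pi> permutes {..n}" for s \<pi> and n :: nat
    using assms that unfolding exchangeable_events_def by blast
  have "s \<in> A" if "\<pi> permutes {..n}" "s \<circ> \<pi> \<in> A" for s \<pi> and n :: nat
  proof -
    have "(s \<circ> \<pi>) \<circ> inv \<pi> \<in> A"
      by (rule *[OF that(2) permutes_inv[OF that(1)]])
    then show ?thesis using permutes_inv_o[OF that(1)] by (simp add: comp_assoc)
  qed
  with * have "s \<circ> \<pi> \<in> A \<longleftrightarrow> s \<in> A" if "\<pi> permutes {..n}" for s \<pi> and n :: nat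
    using that by blast
  then show ?thesis by (simp add: exchangeable_def indicator_def)
qed

text \<open>The level set of \<open>h\<close> through \<open>s\<close> is an occupation event and
  hence exchangeable.\<close>

lemma exchangeable_occupation_algebra:
  fixes h :: "_ \<Rightarrow> ennreal"
  assumes [measurable]: "h \<in> borel_measurable (occupation_algebra X)"
  shows "exchangeable X h"
  unfolding exchangeable_def
proof (intro allI ballI impI)
  fix \<pi> s and n :: nat assume s: "s \<in> space (trajectories X)" and \<pi>: "\<pi> permutes {..n}"
  have "{t \<in> space (occupation_algebra X). h t = h s} \<in> sets (occupation_algebra X)"
    by measurable
  then have "{t \<in> space (trajectories X). h t = h s} \<in> exchangeable_events X"
    using occupation_events_subset
    by (auto simp: sets_occupation_algebra space_occupation_algebra)
  then show "h (s \<circ> \<pi>) = h s" using s \<pi> by (auto simp: exchangeable_events_def)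
qed

lemma occupation_event:
  assumes "countable X" "B \<subseteq> X"
  shows "{s \<in> space (trajectories X). \<forall>x\<in>B. occupation_numbers X s x = f x} \<in> occupation_events X"
proof -
  have [measurable]: "occupation_numbers X \<in> occupation_algebra X \<rightarrow>\<^sub>M (\<Pi>\<^sub>M x\<in>X. count_space UNIV)"
    unfolding occupation_algebra_def
    by (rule measurable_vimage_algebra1[OF occupation_numbers_funcset])
  have [measurable]: "(\<lambda>s. occupation_numbers X s x) \<in> occupation_algebra X \<rightarrow>\<^sub>M count_space UNIV"
    if "x \<in> B" for x
    using that assms by (intro measurable_compose[OF \<open>occupation_numbers X \<in> _\<close>] measurable_component_singleton) auto
  have [simp]: "countable B" using assms countable_subset by blast
  have "{s \<in> space (occupation_algebra X). \<forall>x\<in>B. occupation_numbers X s x = f x} \<in> sets (occupation_algebra X)"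
    by measurable
  then show ?thesis by (simp add: sets_occupation_algebra space_occupation_algebra)
qed

section \<open>Replacing an initial segment of a trajectory\<close>

text \<open>The initial vertex contributes no factor, so the weight is a function of the multiset of
  steps.\<close>

definition weight :: "('a \<Rightarrow> 'a pmf) \<Rightarrow> 'a list \<Rightarrow> ennreal" where
  "weight K w = (\<Prod>(x, y)\<leftarrow>steps w. ennreal (pmf (K x) y))"

lemma weight_Cons2: "weight K (x # y # w) = ennreal (pmf (K x) y) * weight K (y # w)"
  by (simp add: weight_def)

lemma weight_simps [simp]: "weight K [] = 1" "weight K [x] = 1"
  by (simp_all add: weight_def)

lemma weight_append: "v \<noteq> [] \<Longrightarrow> weight K (v @ u) = weight K v * weight K (last v # u)"
  proof (induction v rule: induct_list012)
  case (2 x)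
  then show ?case by simp
next
  case (3 x y v)
  then show ?case by (simp add: weight_Cons2 mult.assoc)
qed simp

lemma weight_mset_cong: "mset (steps w) = mset (steps w') \<Longrightarrow> weight K w = weight K w'"
  unfolding weight_def prod_mset_prod_list[symmetric] mset_map by simp

definition splice_prefix :: "'a list \<Rightarrow> (nat \<Rightarrow> 'a) \<Rightarrow> nat \<Rightarrow> 'a" where
  "splice_prefix w s = (\<lambda>i. if i < length w then w ! i else s i)"

lemma measurable_splice_prefix:
  assumes "w \<in> lists X"
  shows "splice_prefix w \<in> trajectories X \<rightarrow>\<^sub>M trajectories X"
proof -
  have "(\<lambda>s. splice_prefix w s i) \<in> trajectories X \<rightarrow>\<^sub>M count_space X" for i
    using assms by (cases "i < length w") (auto simp: splice_prefix_def)
  moreover have "(\<lambda>s i. splice_prefix w s i) \<in> space (trajectories X) \<rightarrow> (\<Pi>\<^sub>E i\<in>UNIV. space (count_space X))"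
    using assms by (auto simp: splice_prefix_def space_trajectories)
  ultimately have "(\<lambda>s i. splice_prefix w s i) \<in> trajectories X \<rightarrow>\<^sub>M (\<Pi>\<^sub>M i\<in>UNIV. count_space X)"
    by (intro measurable_PiM_single') auto
  then show ?thesis by (simp add: trajectories_def)
qed

lemma cylinder_append:
  "s \<in> cylinder X (w @ v) \<longleftrightarrow> s \<in> cylinder X w \<and> (\<forall>j<length v. s (length w + j) = v ! j)"
proof -
  have "(\<forall>i<length w + length v. s i = (w @ v) ! i) \<longleftrightarrow>
    (\<forall>i<length w. s i = w ! i) \<and> (\<forall>j<length v. s (length w + j) = v ! j)" (is "?L = ?R")
  proof
    assume L: ?L
    show ?R
    proof (intro conjI allI impI)
      fix i assume "i < length w" then show "s i = w ! i" using L[rule_format, of i] by (simp add: nth_append)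
    next
      fix j assume "j < length v"
      then show "s (length w + j) = v ! j" using L[rule_format, of "length w + j"] by simp
    qed
  next
    assume R: ?R
    show ?L
    proof (intro allI impI)
      fix i assume i: "i < length w + length v"
      show "s i = (w @ v) ! i"
        using R[THEN conjunct1, rule_format, of i] R[THEN conjunct2, rule_format, of "i - length w"] i
        by (cases "i < length w") (auto simp: nth_append)
    qed
  qed
  then show ?thesis by (auto simp: cylinder_def)
qed

lemma splice_prefix_in_cylinder:
  assumes "w \<in> lists X" "s \<in> space (trajectories X)"
  shows "splice_prefix w s \<in> cylinder X u \<longleftrightarrow>
    (\<forall>i<min (length u) (length w). u ! i = w ! i) \<and>
    (\<forall>j<length (drop (length w) u). s (length w + j) = drop (length w) u ! j)" (is "_ \<longleftrightarrow> ?R1 \<and> ?R2")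
proof -
  have "splice_prefix w s \<in> space (trajectories X)"
    using measurable_space[OF measurable_splice_prefix] assms by blast
  moreover have "(\<forall>i<length u. splice_prefix w s i = u ! i) \<longleftrightarrow> ?R1 \<and> ?R2" (is "?L \<longleftrightarrow> _")
  proof
    assume L: ?L
    show "?R1 \<and> ?R2"
    proof (intro conjI allI impI)
      fix i assume "i < min (length u) (length w)"
      then show "u ! i = w ! i" using L[rule_format, of i] by (simp add: splice_prefix_def)
    next
      fix j assume "j < length (drop (length w) u)"
      then show "s (length w + j) = drop (length w) u ! j"
        using L[rule_format, of "length w + j"] by (simp add: splice_prefix_def)
    qed
  next
    assume R: "?R1 \<and> ?R2"
    show ?L
    proof (intro allI impI)
      fix i assume i: "i < length u"
      show "splice_prefix w s i = u ! i"
        using R[THEN conjunct1, rule_format, of i] R[THEN conjunct2, rule_format, of "i - length w"] i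
        by (cases "i < length w") (auto simp: splice_prefix_def)
    qed
  qed
  ultimately show ?thesis by (simp add: cylinder_def)
qed

text \<open>Two segments with the same occupation numbers are rearrangements of each other, so on
  the cylinder the replacement merely permutes the first \<open>length w\<close> times.\<close>

lemma splice_prefix_permutation:
  assumes "mset w = mset w'" "s \<in> cylinder X w"
  shows "\<exists>p. p permutes {..<length w} \<and> splice_prefix w' s = s \<circ> p"
proof -
  obtain p where p: "p permutes {..<length w}" "permute_list p w = w'"
    using assms(1) mset_eq_permutation[of w' w] by metis
  have "splice_prefix w' s i = s (p i)" for i
  proof (cases "i < length w")
    case True
    then have "p i < length w" using permutes_in_image[OF p(1), of i] by auto
    then show ?thesis
      using True assms(2) permute_list_nth[OF p(1) True] p(2)
      by (auto simp: splice_prefix_def cylinder_def)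
  next
    case False
    then have "p i = i" using permutes_not_in[OF p(1)] by auto
    then show ?thesis using False mset_eq_length[OF assms(1)] by (simp add: splice_prefix_def)
  qed
  with p(1) show ?thesis by (intro exI[of _ p]) (auto simp: fun_eq_iff)
qed

text \<open>For \<open>w\<close> ending in \<open>B\<close>, this event makes \<open>w\<close> the
  trajectory up to its last visit to \<open>B\<close>.\<close>

definition last_exit :: "'a set \<Rightarrow> 'a set \<Rightarrow> 'a \<Rightarrow> 'a list \<Rightarrow> (nat \<Rightarrow> 'a) set" where
  "last_exit X B b w = {s \<in> cylinder X w. s (length w) = b \<and> (\<forall>i\<ge>length w. s i \<notin> B)}"

lemma last_exit_sets [measurable]: "last_exit X B b w \<in> sets (trajectories X)"
proof -
  have "last_exit X B b w = cylinder X w \<inter>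
    {s \<in> space (trajectories X). s (length w) = b \<and> (\<forall>i\<ge>length w. s i \<notin> B)}"
    by (auto simp: last_exit_def cylinder_def)
  then show ?thesis by simp
qed

text \<open>If each segment ends in the set that the trajectory has abandoned after the other one,
  neither can be longer. Two sets are allowed because exits across different edges have to be told
  apart.\<close>

lemma last_exit_eq:
  assumes "s \<in> last_exit X B b w" "s \<in> last_exit X B' b' w'"
    and "w \<noteq> []" "w' \<noteq> []" "last w \<in> B'" "last w' \<in> B"
  shows "w = w' \<and> b = b'"
proof -
  have le: "length v' \<le> length v" if "s \<in> last_exit X C d v" "s \<in> last_exit X C' d' v'" "v' \<noteq> []" "last v' \<in> C"
    for v v' C C' d d'
  proof (rule ccontr)
    assume "\<not> length v' \<le> length v"
    then have "s (length v' - 1) \<notin> C" using that(1) by (auto simp: last_exit_def)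
    moreover have "s (length v' - 1) = last v'"
      using that by (auto simp: last_exit_def cylinder_def last_conv_nth)
    ultimately show False using that by simp
  qed
  have "length w = length w'" using le assms by (intro antisym) blast+
  then show ?thesis using assms by (auto simp: last_exit_def cylinder_def intro: nth_equalityI)
qed

text \<open>The hypotheses of the theorem transferred to the edge relation and the law on
  trajectories; \<open>cylinder_prob\<close> takes over from the Markov property.\<close>

locale tree_walk_law = prob_space P
  for P :: "(nat \<Rightarrow> 'a) measure" +
  fixes X :: "'a set" and E :: "'a rel" and K :: "'a \<Rightarrow> 'a pmf" and x0 :: 'a
  assumes countable_X: "countable X" and E_subset: "E \<subseteq> X \<times> X"
    and sym_E: "sym E" and irrefl_E: "irrefl E"
    and side: "\<And>a b. (a, b) \<in> E \<Longrightarrow> b \<notin> side E a b"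
    and x0: "x0 \<in> X" and connected: "\<And>x. x \<in> X \<Longrightarrow> (x0, x) \<in> E\<^sup>*"
    and sets_P: "sets P = sets (trajectories X)"
    and cylinder_prob: "\<And>w. w \<in> lists X \<Longrightarrow> w \<noteq> [] \<Longrightarrow>
      emeasure P (cylinder X w) = (if hd w = x0 then weight K w else 0)"
    and nearest: "\<And>x y. x \<in> X \<Longrightarrow> (x, y) \<notin> E \<Longrightarrow> pmf (K x) y = 0"
    and finite_visits: "AE s in P. \<forall>x\<in>X. finite {n. s n = x}"
begin

lemma space_P: "space P = space (trajectories X)"
  using sets_P by (rule sets_eq_imp_space_eq)

lemma weight_zero: "w \<in> lists X \<Longrightarrow> \<not> walk E w \<Longrightarrow> weight K w = 0"
  by (induction w rule: induct_list012) (auto simp: weight_Cons2 nearest)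

lemma measurable_P: "f \<in> trajectories X \<rightarrow>\<^sub>M N \<Longrightarrow> f \<in> P \<rightarrow>\<^sub>M N"
  using measurable_cong_sets[OF sets_P refl] by blast

text \<open>The exceptional trajectories lie in countably many null cylinders, those over lists that
  are not walks from \<open>x0\<close>.\<close>

lemma AE_walk: "AE s in P. \<forall>n. s 0 = x0 \<and> walk E (map s [0..<n])"
proof -
  let ?W = "{w \<in> lists X. w \<noteq> [] \<and> \<not> (hd w = x0 \<and> walk E w)}"
  have "(\<Union>w\<in>?W. cylinder X w) \<in> null_sets P"
  proof (rule null_sets_UN')
    show "countable ?W"
      by (rule countable_subset[OF _ countable_lists[OF countable_X]]) auto
    show "cylinder X w \<in> null_sets P" if "w \<in> ?W" for w
      using that cylinder_prob[of w] weight_zero[of w] by (auto simp: null_sets_def sets_P)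
  qed
  then have "AE s in P. s \<notin> (\<Union>w\<in>?W. cylinder X w)" by (rule AE_not_in)
  then show ?thesis
    using AE_space
  proof eventually_elim
    case (elim s)
    have hd_walk: "hd (map s [0..<Suc n]) = x0 \<and> walk E (map s [0..<Suc n])" for n
    proof -
      have "s \<in> cylinder X (map s [0..<Suc n])" "map s [0..<Suc n] \<in> lists X"
        using elim(2) by (auto simp: cylinder_def space_P space_trajectories simp del: upt_Suc)
      then show ?thesis using elim(1) by (auto simp del: upt_Suc)
    qed
    have "s 0 = x0" using hd_walk[of 0] by simp
    moreover have "walk E (map s [0..<n])" for n
      using hd_walk[of "n - 1"] by (cases n) auto
    ultimately show ?case by simp
  qed
qed

text \<open>The future depends on a segment only through its last vertex, so equal weights and end
  points suffice. Both measures are compared on cylinders: unless \<open>u\<close> contradicts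
  \<open>w'\<close>, each gives, for segments starting at \<open>x0\<close>, the weight of the
  segment times that of the continuation \<open>?d\<close>.\<close>

lemma distr_splice_prefix:
  assumes w: "w \<in> lists X" "w \<noteq> []" and w': "w' \<in> lists X" "length w' = length w"
    and eq: "hd w = hd w'" "last w = last w'" "weight K w = weight K w'"
  shows "distr (density P (indicator (cylinder X w))) (trajectories X) (splice_prefix w') =
    density P (indicator (cylinder X w'))" (is "?L = ?R")
proof (rule trajectories_measure_eqI[OF countable_X])
  have [measurable]: "splice_prefix w' \<in> trajectories X \<rightarrow>\<^sub>M trajectories X"
    using w'(1) by (rule measurable_splice_prefix)
  have meas: "splice_prefix w' \<in> density P (indicator (cylinder X w)) \<rightarrow>\<^sub>M trajectories X"
    by (simp add: measurable_P)
  have cyl: "cylinder X v \<in> sets P" for v by (simp add: sets_P)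
  show "emeasure ?L (cylinder X u) = emeasure ?R (cylinder X u)" if u: "u \<in> lists X" for u
  proof -
    have sv: "splice_prefix w' -` cylinder X u \<inter> space P \<in> sets P"
      using measurable_sets[OF measurable_splice_prefix[OF w'(1)], of "cylinder X u"] by (simp add: sets_P space_P)
    have L: "emeasure ?L (cylinder X u) =
        emeasure P (cylinder X w \<inter> (splice_prefix w' -` cylinder X u \<inter> space P))"
      using emeasure_distr[OF meas, of "cylinder X u"] emeasure_restricted[OF cyl sv] by simp
    have R: "emeasure ?R (cylinder X u) = emeasure P (cylinder X w' \<inter> cylinder X u)"
      using emeasure_restricted[OF cyl cyl] .
    let ?d = "drop (length w') u"
    show ?thesis
    proof (cases "\<forall>i<min (length u) (length w'). u ! i = w' ! i")
      case True
      have "cylinder X w \<inter> (splice_prefix w' -` cylinder X u \<inter> space P) = cylinder X (w @ ?d)"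
      proof (intro set_eqI)
        fix s
        have "s \<in> cylinder X w \<Longrightarrow> s \<in> space (trajectories X)" by (simp add: cylinder_def)
        then show "s \<in> cylinder X w \<inter> (splice_prefix w' -` cylinder X u \<inter> space P) \<longleftrightarrow> s \<in> cylinder X (w @ ?d)"
          using True splice_prefix_in_cylinder[OF w'(1), of s u]
          by (auto simp: cylinder_append space_P w'(2))
      qed
      moreover have "cylinder X w' \<inter> cylinder X u = cylinder X (w' @ ?d)"
      proof (intro set_eqI)
        fix s
        have "splice_prefix w' s = s" if "s \<in> cylinder X w'"
          using that by (auto simp: splice_prefix_def cylinder_def fun_eq_iff)
        moreover have "s \<in> cylinder X w' \<Longrightarrow> s \<in> space (trajectories X)" by (simp add: cylinder_def)
        ultimately show "s \<in> cylinder X w' \<inter> cylinder X u \<longleftrightarrow> s \<in> cylinder X (w' @ ?d)"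
          using True splice_prefix_in_cylinder[OF w'(1), of s u] by (auto simp: cylinder_append)
      qed
      moreover have "w' \<noteq> []" using w w' by auto
      moreover have "set ?d \<subseteq> X" using u set_drop_subset[of "length w'" u] by auto
      ultimately show ?thesis
        unfolding L R using w w' eq
        by (simp add: cylinder_prob weight_append lists_eq_set)
    next
      case False
      then have "cylinder X w \<inter> (splice_prefix w' -` cylinder X u \<inter> space P) = {}"
        using splice_prefix_in_cylinder[OF w'(1), of _ u] by (auto simp: space_P)
      moreover have "cylinder X w' \<inter> cylinder X u = {}"
        using False by (auto simp: cylinder_def)
      ultimately show ?thesis unfolding L R by simp
    qed
  qed
  show "emeasure ?L (space (trajectories X)) \<noteq> \<infinity>"
  proof -
    have "splice_prefix w' -` space (trajectories X) \<inter> space P = space P"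
      using measurable_space[OF measurable_splice_prefix[OF w'(1)]] by (auto simp: space_P)
    then have "emeasure ?L (space (trajectories X)) = emeasure P (cylinder X w \<inter> space P)"
      using emeasure_distr[OF meas, of "space (trajectories X)"]
        emeasure_restricted[OF cyl sets.top, of w] by simp
    then show ?thesis by (simp add: emeasure_eq_measure)
  qed
qed (simp_all add: sets_P)

text \<open>Change of variables by \<open>splice_prefix w'\<close>: it carries one restricted law to
  the other, leaves \<open>h\<close> unchanged because it permutes finitely many times, and does not
  touch the trajectory from the exit on.\<close>

lemma emeasure_last_exit_cong:
  fixes h :: "_ \<Rightarrow> ennreal"
  assumes h: "h \<in> borel_measurable P" "exchangeable X h"
    and w: "w \<in> lists X" "w \<noteq> []" and w': "w' \<in> lists X"
    and eq: "hd w = hd w'" "last w = last w'" "weight K w = weight K w'" "mset w = mset w'"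
  shows "emeasure (density P h) (last_exit X B b w) = emeasure (density P h) (last_exit X B b w')"
proof -
  let ?n = "length w"
  define F where "F = {s \<in> space (trajectories X). s ?n = b \<and> (\<forall>i\<ge>?n. s i \<notin> B)}"
  have F [measurable]: "F \<in> sets (trajectories X)" unfolding F_def by simp
  have h' [measurable]: "h \<in> borel_measurable (trajectories X)"
    using h(1) measurable_cong_sets[OF sets_P refl] by blast
  note meas = measurable_splice_prefix[OF w']
  note meas [measurable]
  have len: "length w' = ?n" using mset_eq_length[OF eq(4)] by simp
  have lx: "indicator (last_exit X B b v) s = (indicator (cylinder X v) s * indicator F s :: ennreal)"
    if "length v = ?n" for v s
    using that by (auto simp: last_exit_def F_def cylinder_def split: split_indicator)
  have "emeasure (density P h) (last_exit X B b w') = (\<integral>\<^sup>+s. h s * indicator (last_exit X B b w') s \<partial>P)"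
    using h(1) by (intro emeasure_density) (auto simp: sets_P)
  also have "\<dots> = (\<integral>\<^sup>+s. indicator (cylinder X w') s * (h s * indicator F s) \<partial>P)"
    using lx[OF len] by (simp add: ac_simps)
  also have "\<dots> = (\<integral>\<^sup>+s. h s * indicator F s \<partial>density P (indicator (cylinder X w')))"
    by (intro nn_integral_density[symmetric] measurable_P) auto
  also have "\<dots> = (\<integral>\<^sup>+s. h s * indicator F s
      \<partial>distr (density P (indicator (cylinder X w))) (trajectories X) (splice_prefix w'))"
    using distr_splice_prefix[OF w w' len eq(1-3)] by simp
  also have "\<dots> = (\<integral>\<^sup>+s. h (splice_prefix w' s) * indicator F (splice_prefix w' s)
      \<partial>density P (indicator (cylinder X w)))"
    by (intro nn_integral_distr) (auto intro!: measurable_P)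
  also have "\<dots> = (\<integral>\<^sup>+s. indicator (cylinder X w) s *
      (h (splice_prefix w' s) * indicator F (splice_prefix w' s)) \<partial>P)"
    by (intro nn_integral_density measurable_P) auto
  also have "\<dots> = (\<integral>\<^sup>+s. h s * indicator (last_exit X B b w) s \<partial>P)"
  proof (intro nn_integral_cong)
    fix s assume "s \<in> space P"
    show "indicator (cylinder X w) s * (h (splice_prefix w' s) * indicator F (splice_prefix w' s)) =
      h s * indicator (last_exit X B b w) s"
    proof (cases "s \<in> cylinder X w")
      case True
      obtain p where p: "p permutes {..<?n}" "splice_prefix w' s = s \<circ> p"
        using splice_prefix_permutation[OF eq(4) True] by blast
      \<comment> \<open>\<open>exchangeable\<close> speaks of \<open>{..n}\<close>, so the last
        permuted index is \<open>?n - 1\<close>; here \<open>w\<close> is nonempty.\<close>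
      have "{..<?n} = {..?n - 1}" using w(2) by (cases w) (auto simp: lessThan_Suc_atMost)
      then have "h (splice_prefix w' s) = h s"
        using h(2) p \<open>s \<in> space P\<close> by (auto simp: exchangeable_def space_P)
      moreover have "splice_prefix w' s \<in> F \<longleftrightarrow> s \<in> F"
        using measurable_space[OF meas] \<open>s \<in> space P\<close>
        by (auto simp: F_def splice_prefix_def len space_P)
      ultimately show ?thesis using True lx[of w s] by (auto split: split_indicator)
    next
      case False
      then show ?thesis using lx[of w s] by simp
    qed
  qed
  also have "\<dots> = emeasure (density P h) (last_exit X B b w)"
    using h(1) by (intro emeasure_density[symmetric]) (auto simp: sets_P)
  finally show ?thesis by simp
qed

end

section \<open>The last exit from one side of an edge\<close>

lemma (in edge_cut) loops_trace:
  assumes "walk E w" "w \<noteq> []" "hd w \<in> B" "last w \<in> B"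
  shows "loops (trace w) = count_list (steps w) (a, b)"
  using ex_excursions[OF assms] by auto

text \<open>Both directions of the crossing involve \<open>b\<close>, so a walk avoiding
  \<open>b\<close> cannot change sides.\<close>

lemma (in edge_cut) walk_on_one_side:
  assumes "walk E c" "b \<notin> set c"
  shows "set c \<subseteq> B \<or> set c \<inter> B = {}"
  using assms
proof (induction c rule: induct_list012)
  case (3 x y c)
  then have "(x, y) \<in> E" "y \<noteq> b" "x \<noteq> b" by auto
  then have "x \<in> B \<longleftrightarrow> y \<in> B" using leave enter by blast
  then show ?case using 3 by auto
qed auto

lemma walk_subset: "walk E w \<Longrightarrow> E \<subseteq> X \<times> X \<Longrightarrow> w \<noteq> [] \<Longrightarrow> hd w \<in> X \<Longrightarrow> w \<in> lists X"
  by (induction w rule: induct_list012) auto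

lemma count_map_upt: "count (mset (map s [0..<n])) x = card {i. i < n \<and> s i = x}"
proof (induction n)
  case (Suc n)
  have "{i. i < Suc n \<and> s i = x} = (if s n = x then {n} else {}) \<union> {i. i < n \<and> s i = x}"
    by (auto simp: less_Suc_eq)
  then show ?case using Suc by (auto simp: card_insert_if)
qed auto

lemma map_cylinder: "s \<in> cylinder X w \<Longrightarrow> map s [0..<length w] = w"
  by (auto simp: cylinder_def intro: nth_equalityI)

context tree_walk_law
begin

lemma cut: "(a, b) \<in> E \<Longrightarrow> edge_cut E (side E a b) a b"
  by (rule edge_cut_side[OF sym_E irrefl_E side])

abbreviation root_walks :: "'a \<Rightarrow> 'a \<Rightarrow> 'a list \<Rightarrow> 'a list set" where
  "root_walks a b \<equiv> edge_cut.walks E (side E a b) a x0"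

text \<open>The trajectory finally leaves the side of \<open>a\<close> across \<open>(a, b)\<close>,
  with trace \<open>t\<close> there; the union leaves the excursions open.\<close>

definition exit_event :: "'a \<Rightarrow> 'a \<Rightarrow> 'a list \<Rightarrow> (nat \<Rightarrow> 'a) set" where
  "exit_event a b t = (\<Union>w\<in>root_walks a b t. last_exit X (side E a b) b w)"

lemma walksD:
  assumes "(a, b) \<in> E" "w \<in> root_walks a b t"
  shows "w \<noteq> []" "walk E w" "hd w = x0" "last w = a" "edge_cut.trace (side E a b) w = t"
    "w \<in> lists X" "last w \<in> side E a b"
proof -
  interpret cut: edge_cut E "side E a b" a b by (rule cut) fact
  show *: "w \<noteq> []" "walk E w" "hd w = x0" "last w = a" "edge_cut.trace (side E a b) w = t"
    using assms(2) by (auto simp: cut.walks_def)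
  show "w \<in> lists X" using walk_subset[OF *(2) E_subset *(1)] x0 *(3) by auto
  show "last w \<in> side E a b" using *(4) cut.tail_in by simp
qed

lemma countable_walks: "(a, b) \<in> E \<Longrightarrow> countable (root_walks a b t)"
  by (rule countable_subset[OF _ countable_lists[OF countable_X]]) (use walksD(6) in blast)

lemma exit_event_sets: "(a, b) \<in> E \<Longrightarrow> exit_event a b t \<in> sets P"
  unfolding exit_event_def sets_P by (intro sets.countable_UN'' countable_walks) auto

section \<open>Comparison of exit events with equal occupation numbers\<close>

lemma emeasure_density_eq_AE:
  assumes "h \<in> borel_measurable P" "AE s in P. s \<in> A \<longleftrightarrow> s \<in> B" "A \<in> sets P" "B \<in> sets P"
  shows "emeasure (density P h) A = emeasure (density P h) B"
  using assms by (intro emeasure_eq_AE) (auto simp: AE_density)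

text \<open>Every edge of a tree is a cut and the vertices can be coloured by signs, so the
  occupation numbers fix the steps and with them the weight.\<close>

lemma weight_walk_cong:
  assumes "walk E w" "w \<noteq> []" "walk E w'" "w' \<noteq> []" "hd w = hd w'" "last w = last w'" "mset w = mset w'"
  shows "weight K w = weight K w'"
proof -
  obtain \<epsilon> :: "'a \<Rightarrow> int" where \<epsilon>: "\<forall>(y, z)\<in>E. \<epsilon> y = - \<epsilon> z" "\<forall>y. \<epsilon> y \<noteq> 0"
    using ex_sign[OF sym_E, of x0] connected E_subset side by blast
  show ?thesis
    by (rule weight_mset_cong, rule mset_steps_cong[where \<epsilon> = \<epsilon> and E = E])
      (use assms \<epsilon> cut in blast)+
qed

text \<open>Both traces have as many loops as their walks cross \<open>(a, b)\<close>, and that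
  number depends only on the end points and the visits to the side.\<close>

lemma loops_cong:
  assumes ab: "(a, b) \<in> E" and x0_side: "x0 \<in> side E a b"
    and w: "w \<in> root_walks a b t" and w': "w' \<in> root_walks a b t'" and "mset t = mset t'"
  shows "edge_cut.loops a t = edge_cut.loops a t'"
proof -
  interpret cut: edge_cut E "side E a b" a b by (rule cut) fact
  obtain \<epsilon> :: "'a \<Rightarrow> int" where \<epsilon>: "\<forall>(y, z)\<in>E. \<epsilon> y = - \<epsilon> z" "\<forall>y. \<epsilon> y \<noteq> 0"
    using ex_sign[OF sym_E, of x0] connected E_subset side by blast
  have "count_list (steps w) (a, b) = count_list (steps w') (a, b)"
    by (rule cut.crossings_cong[where \<epsilon> = \<epsilon>])
      (use \<epsilon> walksD[OF ab w] walksD[OF ab w'] assms(5) in \<open>auto simp: cut.trace_def\<close>)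
  then show ?thesis
    using cut.loops_trace[of w] cut.loops_trace[of w'] walksD[OF ab w] walksD[OF ab w'] x0_side by simp
qed

text \<open>Both events split into pieces indexed by the same excursion lists. Swapping the trace
  under fixed excursions preserves end points, occupation numbers and thus the weight, so the pieces
  have equal measure.\<close>

lemma emeasure_exit_event_cong:
  assumes h: "h \<in> borel_measurable P" "exchangeable X h"
    and ab: "(a, b) \<in> E" and x0_side: "x0 \<in> side E a b"
    and w: "w \<in> root_walks a b t" and w': "w' \<in> root_walks a b t'" and mset: "mset t = mset t'"
  shows "emeasure (density P h) (exit_event a b t) = emeasure (density P h) (exit_event a b t')"
proof -
  interpret cut: edge_cut E "side E a b" a b by (rule cut) fact
  have ba: "(b, a) \<in> E" using ab sym_E by (auto dest: symD)
  let ?\<mu> = "\<lambda>r us. emeasure (density P h) (last_exit X (side E a b) b (cut.insert_excursions r us))"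
  have bij: "bij_betw (cut.insert_excursions r) (cut.excursion_lists r) (root_walks a b r)" if "v \<in> root_walks a b r" for v r
    using cut.bij_betw_walks[OF that x0_side ab ba] .
  have eq: "emeasure (density P h) (exit_event a b r) = (\<integral>\<^sup>+us. ?\<mu> r us \<partial>count_space (cut.excursion_lists r))"
    if v: "v \<in> root_walks a b r" for v r
  proof -
    have exit: "exit_event a b r =
      (\<Union>us\<in>cut.excursion_lists r. last_exit X (side E a b) b (cut.insert_excursions r us))"
      unfolding exit_event_def bij_betw_imp_surj_on[OF bij[OF v], symmetric] by simp
    have inj: "inj_on (cut.insert_excursions r) (cut.excursion_lists r)" using bij[OF v] by (rule bij_betw_imp_inj_on)
    have mem: "cut.insert_excursions r us \<in> root_walks a b r" if "us \<in> cut.excursion_lists r" for us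
      using bij_betw_imp_surj_on[OF bij[OF v]] that by blast
    show ?thesis unfolding exit
    proof (rule emeasure_UN_countable)
      show "countable (cut.excursion_lists r)"
        using countable_walks[OF ab] bij[OF v] countable_image_inj_on inj
        by (metis bij_betw_imp_surj_on)
      show "disjoint_family_on
          (\<lambda>us. last_exit X (side E a b) b (cut.insert_excursions r us)) (cut.excursion_lists r)"
        unfolding disjoint_family_on_def
      proof (intro ballI impI)
        fix us us' assume us: "us \<in> cut.excursion_lists r" "us' \<in> cut.excursion_lists r" "us \<noteq> us'"
        then have "cut.insert_excursions r us \<noteq> cut.insert_excursions r us'"
          using inj by (auto dest: inj_onD)
        then show "last_exit X (side E a b) b (cut.insert_excursions r us) \<inter>
            last_exit X (side E a b) b (cut.insert_excursions r us') = {}"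
          using last_exit_eq walksD[OF ab mem[OF us(1)]] walksD[OF ab mem[OF us(2)]]
          by (metis disjoint_iff)
      qed
    qed (simp add: sets_P)
  qed
  have family: "cut.excursion_lists t = cut.excursion_lists t'"
    unfolding cut.excursion_lists_def using loops_cong[OF ab x0_side w w' mset] by simp
  have "?\<mu> t us = ?\<mu> t' us" if us: "us \<in> cut.excursion_lists t" for us
  proof -
    have v: "cut.insert_excursions t us \<in> root_walks a b t" (is "?v \<in> _")
      using bij_betw_imp_surj_on[OF bij[OF w]] us by blast
    have v': "cut.insert_excursions t' us \<in> root_walks a b t'" (is "?v' \<in> _")
      using bij_betw_imp_surj_on[OF bij[OF w']] us family by blast
    have m: "mset ?v = mset ?v'"
      using cut.mset_insert_excursions us family mset by metis
    note d = walksD[OF ab v] and d' = walksD[OF ab v']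
    have "weight K ?v = weight K ?v'"
      using d d' m by (intro weight_walk_cong) simp_all
    with h d d' m show ?thesis
      by (intro emeasure_last_exit_cong) simp_all
  qed
  then show ?thesis
    unfolding eq[OF w] eq[OF w'] by (subst nn_integral_cong[where v = "?\<mu> t'"]) (auto simp: family)
qed

text \<open>The segment up to the last exit is unique by \<open>last_exit_eq\<close>, and it
  determines its end point and its trace.\<close>

lemma disjoint_exit_events:
  assumes "(a, b) \<in> E" "(a', b') \<in> E" "s \<in> exit_event a b t" "s \<in> exit_event a' b' t'"
    and "a \<in> side E a' b'" "a' \<in> side E a b"
  shows "a = a' \<and> b = b' \<and> t = t'"
proof -
  obtain w w' where w: "w \<in> root_walks a b t" "s \<in> last_exit X (side E a b) b w"
    and w': "w' \<in> root_walks a' b' t'" "s \<in> last_exit X (side E a' b') b' w'"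
    using assms(3,4) by (auto simp: exit_event_def)
  note d = walksD[OF assms(1) w(1)] and d' = walksD[OF assms(2) w'(1)]
  have "w = w' \<and> b = b'"
    by (rule last_exit_eq[OF w(2) w'(2)]) (use d d' assms in auto)
  then show ?thesis using d d' by auto
qed

text \<open>Because \<open>A\<close> is finite, the prescribed occupation numbers force a last visit
  to the side; the exit there is across \<open>(a, b)\<close>, and the trace lists \<open>A\<close>
  in some order.\<close>

lemma AE_occupation:
  assumes ab: "(a, b) \<in> E" and x0_side: "x0 \<in> side E a b" and A: "set_mset A \<subseteq> side E a b"
  shows "AE s in P. (\<forall>x\<in>side E a b. occupation_numbers X s x = enat (count A x)) \<longleftrightarrow>
    s \<in> (\<Union>t\<in>{t. mset t = A}. exit_event a b t)"
  using AE_walk finite_visits AE_space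
proof eventually_elim
  case (elim s)
  interpret cut: edge_cut E "side E a b" a b by (rule cut) fact
  let ?B = "side E a b"
  have sX: "?B \<subseteq> X" using side_subset[OF E_subset] ab E_subset by blast
  have step: "(s n, s (Suc n)) \<in> E" for n
    using elim(1)[rule_format, of "Suc (Suc n)"] by (simp add: successively_append_iff)
  show ?case
  proof
    assume occ: "\<forall>x\<in>?B. occupation_numbers X s x = enat (count A x)"
    have card: "card {n. s n = x} = count A x" if "x \<in> ?B" for x
    proof -
      have "x \<in> X" using that sX by blast
      then show ?thesis using occ elim(2) that by (auto simp: occupation_numbers_def)
    qed
    have fin: "finite {n. s n = x}" if "x \<in> ?B" for x using that elim(2) sX by blast
    \<comment> \<open>The side may be infinite, and transience bounds the visits to single vertices
      only; finiteness holds because vertices of the side outside \<open>A\<close> are not visited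
      at all.\<close>
    have "{n. s n \<in> ?B} = (\<Union>x\<in>set_mset A. {n. s n = x})"
    proof (intro equalityI subsetI)
      fix n assume n: "n \<in> {n. s n \<in> ?B}"
      then have "card {m. s m = s n} > 0" using fin[of "s n"] by (auto simp: card_gt_0_iff)
      then have "s n \<in># A" using card[of "s n"] n by (auto simp flip: count_greater_zero_iff)
      then show "n \<in> (\<Union>x\<in>set_mset A. {n. s n = x})" by auto
    qed (use A in auto)
    then have finB: "finite {n. s n \<in> ?B}" using fin A by auto
    define m where "m = Max {n. s n \<in> ?B}"
    have "0 \<in> {n. s n \<in> ?B}" using elim(1) x0_side by auto
    then have m: "s m \<in> ?B" using Max_in[OF finB] m_def by auto
    have after: "s i \<notin> ?B" if "m < i" for i
      using Max_ge[OF finB, of i] that unfolding m_def by auto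
    have sm: "s m = a" "s (Suc m) = b"
      using cut.leave[OF step m after] by auto
    define w where "w = map s [0..<Suc m]"
    have "w \<noteq> []" "walk E w" "hd w = x0" "last w = a"
      using elim(1)[rule_format, of "Suc m"] sm(1)
      by (simp_all add: w_def hd_map last_map del: upt_Suc)
    then have w: "w \<in> root_walks a b (cut.trace w)" by (simp add: cut.walks_def)
    have exit: "s \<in> last_exit X ?B b w"
      using after sm elim(3)
      by (auto simp: last_exit_def cylinder_def w_def space_P simp del: upt_Suc)
    have "mset (cut.trace w) = A"
    proof (rule multiset_eqI)
      fix x
      show "count (mset (cut.trace w)) x = count A x"
      proof (cases "x \<in> ?B")
        case True
        then have "i < Suc m" if "s i = x" for i using after[of i] that by (cases "m < i") auto
        then have "{i. i < Suc m \<and> s i = x} = {i. s i = x}" by auto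
        then have "count (mset w) x = count A x"
          using card[OF True] unfolding w_def count_map_upt by simp
        then show ?thesis using True by (simp add: cut.trace_def mset_filter)
      next
        case False
        then have "count A x = 0" using A by (auto simp: count_eq_zero_iff)
        then show ?thesis using False by (simp add: cut.trace_def mset_filter)
      qed
    qed
    then show "s \<in> (\<Union>t\<in>{t. mset t = A}. exit_event a b t)"
      using w exit by (auto simp: exit_event_def)
  next
    assume "s \<in> (\<Union>t\<in>{t. mset t = A}. exit_event a b t)"
    then obtain t w where t: "mset t = A" and w: "w \<in> root_walks a b t" and s: "s \<in> last_exit X ?B b w"
      by (auto simp: exit_event_def)
    show "\<forall>x\<in>?B. occupation_numbers X s x = enat (count A x)"
    proof
      fix x assume x: "x \<in> ?B"
      have "i < length w" if "s i = x" for i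
        using that x s by (cases "i < length w") (auto simp: last_exit_def)
      then have "{i. i < length w \<and> s i = x} = {i. s i = x}" by auto
      moreover have "map s [0..<length w] = w" using s by (intro map_cylinder) (auto simp: last_exit_def)
      ultimately have "card {i. s i = x} = count (mset w) x"
        using count_map_upt[of s "length w" x] by simp
      also have "\<dots> = count (mset t) x"
        using x walksD(5)[OF ab w] by (auto simp: cut.trace_def mset_filter)
      finally have "card {i. s i = x} = count A x" using t by simp
      then show "occupation_numbers X s x = enat (count A x)"
        using x sX elim(2) by (auto simp: occupation_numbers_def)
    qed
  qed
qed

text \<open>Prescribing the occupation numbers on the side as in \<open>t\<close> gives an
  occupation event \<open>C\<close> that is almost surely the disjoint union of finitely many exit
  events. Under an exchangeable density they all have the same measure, so each carries the share
  \<open>1 / card T\<close> of \<open>C\<close>.\<close>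

lemma emeasure_exit_event_eq:
  assumes h1: "h1 \<in> borel_measurable P" "exchangeable X h1"
    and h2: "h2 \<in> borel_measurable P" "exchangeable X h2"
    and eq: "\<And>C. C \<in> occupation_events X \<Longrightarrow> emeasure (density P h1) C = emeasure (density P h2) C"
    and ab: "(a, b) \<in> E" and x0_side: "x0 \<in> side E a b"
  shows "emeasure (density P h1) (exit_event a b t) = emeasure (density P h2) (exit_event a b t)"
proof (cases "root_walks a b t = {}")
  case True
  then show ?thesis by (simp add: exit_event_def)
next
  case False
  then obtain w where w: "w \<in> root_walks a b t" by blast
  interpret cut: edge_cut E "side E a b" a b by (rule cut) fact
  \<comment> \<open>Traces realised by no walk are dropped: their exit events are empty and would
    spoil the equality of measures.\<close>
  define T where "T = {t'. mset t' = mset t \<and> root_walks a b t' \<noteq> {}}"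
  have "T \<subseteq> {t'. set t' \<subseteq> set t \<and> length t' = length t}"
    by (auto simp: T_def dest: mset_eq_setD mset_eq_length)
  then have finT: "finite T" by (rule finite_subset) (simp add: finite_lists_length_eq)
  have tT: "t \<in> T" using False by (simp add: T_def)
  have tB: "set_mset (mset t) \<subseteq> side E a b"
    using walksD(5)[OF ab w] by (auto simp: cut.trace_def)
  define C where "C = {s \<in> space (trajectories X).
    \<forall>x\<in>side E a b. occupation_numbers X s x = enat (count (mset t) x)}"
  have "side E a b \<subseteq> X" using side_subset[OF E_subset] ab E_subset by blast
  then have C: "C \<in> occupation_events X"
    unfolding C_def by (rule occupation_event[OF countable_X])
  then have CP: "C \<in> sets P"
    using occupation_events_subset[of X] by (auto simp: exchangeable_events_def sets_P)
  have UP: "(\<Union>t'\<in>T. exit_event a b t') \<in> sets P"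
    using finT exit_event_sets[OF ab] by blast
  have AE: "AE s in P. s \<in> C \<longleftrightarrow> s \<in> (\<Union>t'\<in>T. exit_event a b t')"
    using AE_occupation[OF ab x0_side tB] AE_space
  proof eventually_elim
    case (elim s)
    have "(\<Union>t'\<in>{t'. mset t' = mset t}. exit_event a b t') = (\<Union>t'\<in>T. exit_event a b t')"
      by (auto simp: T_def exit_event_def)
    then show ?case using elim by (simp add: C_def space_P)
  qed
  have disj: "disjoint_family_on (exit_event a b) T"
    unfolding disjoint_family_on_def
    using disjoint_exit_events[OF ab ab] cut.tail_in by blast
  have sum: "emeasure (density P h) C = of_nat (card T) * emeasure (density P h) (exit_event a b t)"
    if h: "h \<in> borel_measurable P" "exchangeable X h" for h
  proof -
    have "emeasure (density P h) C = emeasure (density P h) (\<Union>t'\<in>T. exit_event a b t')"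
      by (rule emeasure_density_eq_AE[OF h(1) AE CP UP])
    also have "\<dots> = (\<Sum>t'\<in>T. emeasure (density P h) (exit_event a b t'))"
      using exit_event_sets[OF ab] by (intro sum_emeasure[symmetric] disj finT) auto
    also have "\<dots> = (\<Sum>t'\<in>T. emeasure (density P h) (exit_event a b t))"
    proof (rule sum.cong)
      fix t' assume "t' \<in> T"
      then obtain w' where "w' \<in> root_walks a b t'" "mset t' = mset t" by (auto simp: T_def)
      then show "emeasure (density P h) (exit_event a b t') = emeasure (density P h) (exit_event a b t)"
        using emeasure_exit_event_cong[OF h ab x0_side _ w] by blast
    qed simp
    finally show ?thesis by simp
  qed
  have "card T \<noteq> 0" using finT tT by auto
  then show ?thesis
    using eq[OF C] sum[OF h1] sum[OF h2] by (simp add: ennreal_mult_cancel_left)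
qed

text \<open>Index set for splitting the cylinder over \<open>c\<close>: the edge by which the
  trajectory leaves the vertices of \<open>c\<close> for good, and the trace on the side of that
  edge, which starts with \<open>c\<close>.\<close>

definition boundary :: "'a list \<Rightarrow> ('a \<times> 'a \<times> 'a list) set" where
  "boundary c = {(a, b, t). (a, b) \<in> E \<and> a \<in> set c \<and> b \<notin> set c \<and> t \<in> lists X \<and> (\<exists>r. t = c @ r)}"

lemma countable_boundary: "countable (boundary c)"
proof (rule countable_subset)
  show "boundary c \<subseteq> X \<times> X \<times> lists X" using E_subset by (auto simp: boundary_def)
  show "countable (X \<times> X \<times> lists X)" using countable_X by (intro countable_SIGMA countable_lists)
qed

lemma boundary_side:
  assumes "walk E c" "(a, b, t) \<in> boundary c"
  shows "set c \<subseteq> side E a b"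
proof -
  have ab: "(a, b) \<in> E" "a \<in> set c" "b \<notin> set c" using assms(2) by (auto simp: boundary_def)
  interpret cut: edge_cut E "side E a b" a b by (rule cut) fact
  show ?thesis using cut.walk_on_one_side[OF assms(1) ab(3)] ab(2) cut.tail_in by blast
qed

text \<open>The edge \<open>(a, b)\<close> is the one crossed right after the last visit to the set of vertices
  of \<open>c\<close>.\<close>

text \<open>The edge \<open>(a, b)\<close> is the one crossed right after the last visit to the set of vertices
  of \<open>c\<close>.\<close>

lemma AE_cylinder:
  assumes c: "walk E c" "c \<noteq> []" "hd c = x0"
  shows "AE s in P. s \<in> cylinder X c \<longleftrightarrow> s \<in> (\<Union>(a, b, t)\<in>boundary c. exit_event a b t)"
  using AE_walk finite_visits AE_space
proof eventually_elim
  case (elim s)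
  have cX: "c \<in> lists X" using walk_subset[OF c(1) E_subset c(2)] c(3) x0 by simp
  have step: "(s n, s (Suc n)) \<in> E" for n
    using elim(1)[rule_format, of "Suc (Suc n)"] by (simp add: successively_append_iff)
  have sX: "s n \<in> X" for n using elim(3) by (simp add: space_P space_trajectories)
  show ?case
  proof
    assume s: "s \<in> cylinder X c"
    have "{n. s n \<in> set c} = (\<Union>x\<in>set c. {n. s n = x})" by auto
    then have fin: "finite {n. s n \<in> set c}" using elim(2) cX by auto
    define m where "m = Max {n. s n \<in> set c}"
    have sc: "s i = c ! i" if "i < length c" for i using s that by (auto simp: cylinder_def)
    have c_visit: "i \<in> {n. s n \<in> set c}" if "i < length c" for i using sc[OF that] that by auto
    have m: "s m \<in> set c" using Max_in[OF fin] c_visit[of 0] c(2) unfolding m_def by blast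
    have after: "s i \<notin> set c" if "m < i" for i
      using Max_ge[OF fin, of i] that unfolding m_def by auto
    have len: "length c \<le> Suc m"
      using Max_ge[OF fin c_visit[of "length c - 1"]] c(2) unfolding m_def[symmetric] by (cases c) auto
    define a b where "a = s m" and "b = s (Suc m)"
    have ab: "(a, b) \<in> E" "a \<in> set c" "b \<notin> set c"
      using step m after by (auto simp: a_def b_def)
    interpret cut: edge_cut E "side E a b" a b by (rule cut) fact
    define w where "w = map s [0..<Suc m]"
    have "w \<noteq> []" "walk E w" "hd w = x0" "last w = a"
      using elim(1)[rule_format, of "Suc m"]
      by (simp_all add: w_def a_def hd_map last_map del: upt_Suc)
    then have w: "w \<in> root_walks a b (cut.trace w)" by (simp add: cut.walks_def)
    have "take (length c) w = c"
      using len sc by (intro nth_equalityI) (auto simp: w_def simp del: upt_Suc)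
    then have wc: "w = c @ drop (length c) w" by (metis append_take_drop_id)
    have cB: "set c \<subseteq> side E a b"
      using cut.walk_on_one_side[OF c(1) ab(3)] ab(2) cut.tail_in by blast
    then have "cut.trace c = c" unfolding cut.trace_def filter_id_conv by blast
    then have trace: "cut.trace w = c @ cut.trace (drop (length c) w)"
      by (subst wc) (simp del: append_take_drop_id)
    have "cut.trace w \<in> lists X" using sX by (auto simp: cut.trace_def w_def)
    then have "(a, b, cut.trace w) \<in> boundary c" using ab trace by (auto simp: boundary_def)
    \<comment> \<open>The side can only be reentered at \<open>a\<close>, a vertex of
      \<open>c\<close> that is not visited after time \<open>m\<close>.\<close>
    moreover have "s i \<notin> side E a b" if "Suc m \<le> i" for i
      using that
    proof (induction i rule: dec_induct)
      case base
      then show ?case using cut.head_notin by (simp add: b_def)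
    next
      case (step i)
      then have "s (Suc i) \<noteq> a" using after[of "Suc i"] ab(2) by auto
      then show ?case using cut.enter[OF \<open>(s i, s (Suc i)) \<in> E\<close> step.IH] by blast
    qed
    then have "s \<in> last_exit X (side E a b) b w"
      using elim(3) by (auto simp: last_exit_def cylinder_def w_def space_P b_def simp del: upt_Suc)
    ultimately show "s \<in> (\<Union>(a, b, t)\<in>boundary c. exit_event a b t)"
      using w by (auto simp: exit_event_def)
  next
    assume "s \<in> (\<Union>(a, b, t)\<in>boundary c. exit_event a b t)"
    then obtain a b t w where t: "(a, b, t) \<in> boundary c" and w: "w \<in> root_walks a b t"
      and s: "s \<in> last_exit X (side E a b) b w"
      by (auto simp: exit_event_def)
    have ab: "(a, b) \<in> E" "\<exists>r. t = c @ r" using t by (auto simp: boundary_def)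
    interpret cut: edge_cut E "side E a b" a b by (rule cut) fact
    have "x0 \<in> side E a b" using boundary_side[OF c(1) t] c(2,3) hd_in_set by blast
    \<comment> \<open>A trace that starts with the walk \<open>c\<close> leaves no room for an
      excursion before \<open>c\<close> is finished.\<close>
    then obtain r where "w = c @ r"
      using cut.prefix_trace[of w c] walksD[OF ab(1) w] c ab(2) by auto
    then show "s \<in> cylinder X c" using s by (simp add: last_exit_def cylinder_append)
  qed
qed

text \<open>The cylinder is almost surely a countable disjoint union of exit events, on each of
  which the two densities agree. If \<open>c\<close> is not a walk from \<open>x0\<close>, the
  cylinder is null.\<close>

lemma emeasure_cylinder_eq:
  assumes h1: "h1 \<in> borel_measurable P" "exchangeable X h1"
    and h2: "h2 \<in> borel_measurable P" "exchangeable X h2"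
    and eq: "\<And>C. C \<in> occupation_events X \<Longrightarrow> emeasure (density P h1) C = emeasure (density P h2) C"
    and c: "c \<in> lists X" "c \<noteq> []"
  shows "emeasure (density P h1) (cylinder X c) = emeasure (density P h2) (cylinder X c)"
proof (cases "walk E c \<and> hd c = x0")
  case True
  then have walk: "walk E c" "hd c = x0" by auto
  have x0_side: "x0 \<in> side E a b" if "(a, b, t) \<in> boundary c" for a b t
    using boundary_side[OF walk(1) that] c(2) walk(2) hd_in_set by blast
  have exit: "(case i of (a, b, t) \<Rightarrow> exit_event a b t) \<in> sets P" if "i \<in> boundary c" for i
    using that exit_event_sets by (auto simp: boundary_def)
  have disj: "disjoint_family_on (\<lambda>(a, b, t). exit_event a b t) (boundary c)"
    unfolding disjoint_family_on_def
  proof (intro ballI impI)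
    fix i i' assume i: "i \<in> boundary c" "i' \<in> boundary c" "i \<noteq> i'"
    obtain a b t a' b' t' where ii: "i = (a, b, t)" "i' = (a', b', t')"
      by (cases i; cases i') auto
    have "(a, b) \<in> E" "(a', b') \<in> E" "a \<in> set c" "a' \<in> set c" using i ii by (auto simp: boundary_def)
    moreover have "set c \<subseteq> side E a b" "set c \<subseteq> side E a' b'"
      using boundary_side[OF walk(1)] i ii by auto
    ultimately show "(case i of (a, b, t) \<Rightarrow> exit_event a b t) \<inter>
        (case i' of (a, b, t) \<Rightarrow> exit_event a b t) = {}"
      using disjoint_exit_events[of a b a' b' _ t t'] i ii by auto
  qed
  have "emeasure (density P h) (cylinder X c) =
      (\<integral>\<^sup>+i. emeasure (density P h) (case i of (a, b, t) \<Rightarrow> exit_event a b t) \<partial>count_space (boundary c))"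
    if h: "h \<in> borel_measurable P" for h
  proof -
    have "emeasure (density P h) (cylinder X c) =
        emeasure (density P h) (\<Union>(a, b, t)\<in>boundary c. exit_event a b t)"
      by (intro emeasure_density_eq_AE[OF h AE_cylinder[OF walk(1) c(2) walk(2)]]
          sets.countable_UN''[OF countable_boundary exit]) (auto simp: sets_P)
    also have "\<dots> = (\<integral>\<^sup>+i. emeasure (density P h) (case i of (a, b, t) \<Rightarrow> exit_event a b t) \<partial>count_space (boundary c))"
      using exit by (intro emeasure_UN_countable countable_boundary disj) auto
    finally show ?thesis .
  qed
  moreover have "(\<integral>\<^sup>+i. emeasure (density P h1) (case i of (a, b, t) \<Rightarrow> exit_event a b t) \<partial>count_space (boundary c)) =
      (\<integral>\<^sup>+i. emeasure (density P h2) (case i of (a, b, t) \<Rightarrow> exit_event a b t) \<partial>count_space (boundary c))"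
  proof (rule nn_integral_cong)
    fix i assume "i \<in> space (count_space (boundary c))"
    then obtain a b t where i: "i = (a, b, t)" "(a, b, t) \<in> boundary c" by (cases i) auto
    then have "(a, b) \<in> E" by (auto simp: boundary_def)
    then show "emeasure (density P h1) (case i of (a, b, t) \<Rightarrow> exit_event a b t) =
        emeasure (density P h2) (case i of (a, b, t) \<Rightarrow> exit_event a b t)"
      using emeasure_exit_event_eq[OF h1 h2 eq _ x0_side[OF i(2)]] i(1) by simp
  qed
  ultimately show ?thesis using h1(1) h2(1) by simp
next
  case False
  then have "emeasure P (cylinder X c) = 0" using c cylinder_prob weight_zero by auto
  then have "AE s in P. s \<in> cylinder X c \<longleftrightarrow> s \<in> {}"
    using AE_not_in[of "cylinder X c" P] by (auto simp: null_sets_def sets_P)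
  then have "emeasure (density P h) (cylinder X c) = 0" if "h \<in> borel_measurable P" for h
    using emeasure_density_eq_AE[OF that, of "cylinder X c" "{}"] by (simp add: sets_P)
  then show ?thesis using h1 h2 by simp
qed

text \<open>Cylinders generate the sigma-field, so an exchangeable density of finite mass is
  determined almost surely by its integrals over occupation events.\<close>

lemma AE_eq_if_exchangeable:
  assumes h1: "h1 \<in> borel_measurable P" "exchangeable X h1"
    and h2: "h2 \<in> borel_measurable P" "exchangeable X h2"
    and eq: "\<And>C. C \<in> occupation_events X \<Longrightarrow> emeasure (density P h1) C = emeasure (density P h2) C"
    and fin: "emeasure (density P h1) (space P) \<noteq> \<infinity>"
  shows "AE s in P. h1 s = h2 s"
proof (rule density_unique[OF h1(1) h2(1)])
  show "density P h1 = density P h2"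
  proof (rule trajectories_measure_eqI[OF countable_X])
    fix w assume w: "w \<in> lists X"
    show "emeasure (density P h1) (cylinder X w) = emeasure (density P h2) (cylinder X w)"
    proof (cases "w = []")
      case True
      have "space (trajectories X) \<in> occupation_events X"
        using sets.top[of "occupation_algebra X"]
        by (simp add: sets_occupation_algebra space_occupation_algebra)
      then show ?thesis using eq True by (simp add: cylinder_Nil)
    next
      case False
      then show ?thesis using emeasure_cylinder_eq[OF h1 h2 eq w] by blast
    qed
  qed (use fin in \<open>simp_all add: sets_P space_P\<close>)
qed

text \<open>Compare the indicator of \<open>A\<close> with its conditional expectation
  \<open>g\<close> given the occupation numbers: both are exchangeable and have the same integrals
  over occupation events, so they agree almost surely. Hence \<open>g\<close> takes only the values
  0 and 1 almost surely, and its level set at 1 serves as \<open>C\<close>.\<close>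

lemma exchangeable_AE_occupation:
  assumes A: "A \<in> exchangeable_events X"
  shows "\<exists>C\<in>occupation_events X. AE s in P. s \<in> A \<longleftrightarrow> s \<in> C"
proof -
  let ?F = "occupation_algebra X"
  have sub: "subalgebra P ?F"
    using occupation_events_subset[of X]
    by (auto simp: subalgebra_def space_P space_occupation_algebra sets_occupation_algebra sets_P
        exchangeable_events_def)
  interpret finite_measure_subalgebra P ?F by standard (rule sub)
  have AP: "A \<in> sets P" using A by (auto simp: exchangeable_events_def sets_P)
  define g where "g = nn_cond_exp P ?F (indicator A)"
  have gF [measurable]: "g \<in> borel_measurable ?F" unfolding g_def by simp
  have gP: "g \<in> borel_measurable P" unfolding g_def by simp
  have A1: "indicator A \<in> borel_measurable P" using AP by simp
  have "AE s in P. indicator A s = g s"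
  proof (rule AE_eq_if_exchangeable[OF A1 exchangeable_indicator[OF A] gP exchangeable_occupation_algebra[OF gF]])
    fix C assume C: "C \<in> occupation_events X"
    then have CP: "C \<in> sets P" using sub by (auto simp: subalgebra_def sets_occupation_algebra)
    have CF: "indicator C \<in> borel_measurable ?F" using C unfolding sets_occupation_algebra[symmetric] by simp
    show "emeasure (density P (indicator A)) C = emeasure (density P g) C"
      using nn_cond_exp_intg[OF CF A1] AP CP gP
      by (simp add: emeasure_density g_def mult.commute)
  next
    show "emeasure (density P (indicator A)) (space P) \<noteq> \<infinity>"
      using emeasure_restricted[OF AP sets.top] by (simp add: emeasure_eq_measure)
  qed
  then have "AE s in P. s \<in> A \<longleftrightarrow> s \<in> {s \<in> space ?F. g s = 1}"
    using AE_space
    by eventually_elim (auto simp: indicator_def space_P space_occupation_algebra split: if_splits)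
  moreover have "{s \<in> space ?F. g s = 1} \<in> occupation_events X"
    unfolding sets_occupation_algebra[symmetric] by measurable
  ultimately show ?thesis by blast
qed

end

section \<open>Completion\<close>

text \<open>Induction by appending a vertex. The Markov property conditions on a history of positive
  probability; for a null history both sides vanish.\<close>

lemma emeasure_cylinder_markov_chain:
  assumes mc: "markov_chain M X K S" and S0: "AE \<omega> in M. S 0 \<omega> = x0" and w: "w \<noteq> []"
  shows "emeasure (trajectory_law M X S) (cylinder X w) = (if hd w = x0 then weight K w else 0)"
proof -
  interpret prob_space M using mc by (simp add: markov_chain_def)
  have S [measurable]: "S n \<in> M \<rightarrow>\<^sub>M count_space X" for n
    using mc by (simp add: markov_chain_def)
  have SX: "S n \<omega> \<in> X" if "\<omega> \<in> space M" for n \<omega>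
    using measurable_space[OF S that] by simp
  have traj: "(\<lambda>\<omega> n. S n \<omega>) \<in> M \<rightarrow>\<^sub>M trajectories X"
    unfolding trajectories_def by (rule measurable_PiM_single') (auto simp: SX)
  have cyl: "{\<omega> \<in> space M. \<forall>i<length v. S i \<omega> = v ! i} \<in> sets M" for v
    using measurable_sets[OF traj cylinder_sets[of X v]]
    by (rule back_subst[where P = "\<lambda>A. A \<in> sets M"])
      (auto simp: cylinder_def space_trajectories SX)
  have "emeasure M {\<omega> \<in> space M. \<forall>i<length w. S i \<omega> = w ! i} = (if hd w = x0 then weight K w else 0)"
    using w
  proof (induction w rule: rev_nonempty_induct)
    case (single x)
    show ?case
    proof (cases "x = x0")
      case True
      then have "emeasure M {\<omega> \<in> space M. \<forall>i<length [x]. S i \<omega> = [x] ! i} = emeasure M (space M)"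
        using S0 cyl[of "[x]"] by (intro emeasure_eq_AE) auto
      then show ?thesis using True emeasure_space_1 by simp
    next
      case False
      then have "emeasure M {\<omega> \<in> space M. \<forall>i<length [x]. S i \<omega> = [x] ! i} = emeasure M {}"
        using S0 cyl[of "[x]"] by (intro emeasure_eq_AE) auto
      then show ?thesis using False by simp
    qed
  next
    case (snoc y v)
    \<comment> \<open>The Markov property is stated for the indices up to \<open>n\<close>, so
      \<open>n\<close> is one less than the length of the history.\<close>
    obtain n where n: "length v = Suc n" using snoc.hyps by (cases v) auto
    have last: "v ! n = last v" using n snoc.hyps by (simp add: last_conv_nth)
    have Q: "{\<omega> \<in> space M. \<forall>i\<le>n. S i \<omega> = v ! i} = {\<omega> \<in> space M. \<forall>i<length v. S i \<omega> = v ! i}"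
      by (simp add: n less_Suc_eq_le)
    have PQ: "{\<omega> \<in> space M. S (Suc n) \<omega> = y \<and> (\<forall>i\<le>n. S i \<omega> = v ! i)} =
        {\<omega> \<in> space M. \<forall>i<length (v @ [y]). S i \<omega> = (v @ [y]) ! i}"
      using n by (auto simp: less_Suc_eq_le nth_append le_Suc_eq)
    have prob: "prob {\<omega> \<in> space M. \<forall>i<length (v @ [y]). S i \<omega> = (v @ [y]) ! i} =
      prob {\<omega> \<in> space M. \<forall>i<length v. S i \<omega> = v ! i} * pmf (K (last v)) y"
    proof (cases "prob {\<omega> \<in> space M. \<forall>i<length v. S i \<omega> = v ! i} > 0")
      case True
      then have "\<P>(\<omega> in M. S (Suc n) \<omega> = y \<bar> \<forall>i\<le>n. S i \<omega> = v ! i) = pmf (K (v ! n)) y"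
        using mc unfolding markov_chain_def Q[symmetric] by blast
      then show ?thesis using True unfolding cond_prob_def PQ Q last by (simp add: field_simps)
    next
      case False
      then have zero: "prob {\<omega> \<in> space M. \<forall>i<length v. S i \<omega> = v ! i} = 0"
        by (meson measure_nonneg antisym_conv2 not_le)
      have "prob {\<omega> \<in> space M. \<forall>i<length (v @ [y]). S i \<omega> = (v @ [y]) ! i} \<le>
          prob {\<omega> \<in> space M. \<forall>i<length v. S i \<omega> = v ! i}"
        by (intro finite_measure_mono cyl) (auto simp: less_Suc_eq nth_append)
      then show ?thesis unfolding zero by (simp add: measure_le_0_iff)
    qed
    have "emeasure M {\<omega> \<in> space M. \<forall>i<length (v @ [y]). S i \<omega> = (v @ [y]) ! i} =
      emeasure M {\<omega> \<in> space M. \<forall>i<length v. S i \<omega> = v ! i} * ennreal (pmf (K (last v)) y)"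
      unfolding emeasure_eq_measure prob by (simp add: ennreal_mult)
    then show ?case
      using snoc by (simp add: weight_append weight_Cons2 del: length_append)
  qed
  moreover have "(\<lambda>\<omega> n. S n \<omega>) -` cylinder X w \<inter> space M = {\<omega> \<in> space M. \<forall>i<length w. S i \<omega> = w ! i}"
    by (auto simp: cylinder_def space_trajectories SX)
  ultimately show ?thesis
    using emeasure_distr[OF traj cylinder_sets] by (simp add: trajectory_law_def)
qed

text \<open>\<open>A\<close> arises from \<open>C\<close> by removing the null set
  \<open>C - A\<close> and adding the null set \<open>A - C\<close>.\<close>

lemma completed_sets_eqI:
  assumes "F \<subseteq> F'" "F' \<subseteq> sets P" and AE: "\<And>A. A \<in> F' \<Longrightarrow> \<exists>C\<in>F. AE s in P. s \<in> A \<longleftrightarrow> s \<in> C"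
  shows "completed_sets P F' = completed_sets P F"
  unfolding completed_sets_def
proof (rule antisym)
  let ?S = "sigma_sets (space P) (F \<union> null_sets (completion P))"
  show "?S \<subseteq> sigma_sets (space P) (F' \<union> null_sets (completion P))"
    using assms by (intro sigma_sets_mono') auto
  have "null_sets (completion P) \<subseteq> Pow (space P)"
    using sets.sets_into_space[of _ "completion P"] by (auto simp: null_sets_def)
  moreover have "F \<subseteq> Pow (space P)" using assms sets.sets_into_space by blast
  ultimately interpret S: sigma_algebra "space P" ?S
    by (intro sigma_algebra_sigma_sets) auto
  have "A \<in> ?S" if A: "A \<in> F'" for A
  proof -
    obtain C where C: "C \<in> F" "AE s in P. s \<in> A \<longleftrightarrow> s \<in> C" using AE[OF A] by blast
    have sets: "A \<in> sets P" "C \<in> sets P" using A C assms by auto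
    have "C - A \<in> null_sets P" "A - C \<in> null_sets P"
      using C(2) sets by (auto simp: AE_iff_null_sets elim: eventually_mono)
    then have "C - A \<in> ?S" "A - C \<in> ?S"
      by (auto intro!: sigma_sets.Basic null_sets_completionI)
    moreover have "C \<in> ?S" using C by (auto intro: sigma_sets.Basic)
    ultimately have "(C - (C - A)) \<union> (A - C) \<in> ?S" by blast
    moreover have "(C - (C - A)) \<union> (A - C) = A" by blast
    ultimately show ?thesis by simp
  qed
  then show "sigma_sets (space P) (F' \<union> null_sets (completion P)) \<subseteq> ?S"
    by (intro sigma_sets_mono) (auto intro: sigma_sets.Basic)
qed

theorem corollary2p1:
  fixes G :: "'a pair_pre_digraph" and K :: "'a \<Rightarrow> 'a pmf" and x0 :: 'a
    and M :: "'w measure" and S :: "nat \<Rightarrow> 'w \<Rightarrow> 'a"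
  defines "X \<equiv> pverts G"
  defines "P \<equiv> trajectory_law M X S"
  assumes "undirected_tree G" and "countable X"
    and "markov_chain M X K S" and "nearest_neighbor G K"
    and "x0 \<in> X" and "AE \<omega> in M. S 0 \<omega> = x0"
    and "transient M X S"
  shows "completed_sets P (exchangeable_events X) = completed_sets P (occupation_events X)"
proof -
  interpret G: pair_bidirected_digraph G
    using assms(3) by (simp add: undirected_tree_def)
  interpret M: prob_space M using assms(5) by (simp add: markov_chain_def)
  have S: "S n \<in> M \<rightarrow>\<^sub>M count_space X" for n
    using assms(5) by (simp add: markov_chain_def)
  have traj: "(\<lambda>\<omega> n. S n \<omega>) \<in> M \<rightarrow>\<^sub>M trajectories X"
    unfolding trajectories_def
    by (rule measurable_PiM_single'[OF S]) (use measurable_space[OF S] in auto)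
  \<comment> \<open>Finiteness of a set of times is expressed as boundedness, whose quantifiers
    range over countable sets; the measurability obtained in this way transfers transience to
    \<open>P\<close>.\<close>
  have "{s \<in> space (trajectories X). \<forall>x\<in>X. \<exists>m. \<forall>n. s n = x \<longrightarrow> n \<le> m} \<in> sets (trajectories X)"
    using \<open>countable X\<close> by simp
  then have "{s \<in> space (trajectories X). \<forall>x\<in>X. finite {n. s n = x}} \<in> sets (trajectories X)"
    by (simp add: finite_nat_set_iff_bounded_le)
  then have fin: "AE s in P. \<forall>x\<in>X. finite {n. s n = x}"
    unfolding P_def trajectory_law_def
    using assms(9) by (subst AE_distr_iff[OF traj]) (simp_all add: transient_def)
  interpret prob_space P
    unfolding P_def trajectory_law_def by (rule M.prob_space_distr[OF traj])
  interpret tree_walk_law P X "parcs G" K x0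
  proof
    show "parcs G \<subseteq> X \<times> X" unfolding X_def using G.in_arcsD1 G.in_arcsD2 by auto
    show "sym (parcs G)" using G.arcs_symmetric by (auto intro: symI)
    show "irrefl (parcs G)" using G.pair_no_loops by (fastforce simp: irrefl_def)
    show "b \<notin> side (parcs G) a b" if "(a, b) \<in> parcs G" for a b
      using tree_side[OF assms(3) that] .
    show "(x0, x) \<in> (parcs G)\<^sup>*" if "x \<in> X" for x
      using tree_connected[OF assms(3)] assms(7) that by (simp add: X_def)
    show "sets P = sets (trajectories X)" by (simp add: P_def trajectory_law_def)
    show "emeasure P (cylinder X w) = (if hd w = x0 then weight K w else 0)" if "w \<noteq> []" for w
      unfolding P_def by (rule emeasure_cylinder_markov_chain[OF assms(5,8) that])
    show "pmf (K x) y = 0" if "x \<in> X" "(x, y) \<notin> parcs G" for x y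
      using assms(6) that by (auto simp: nearest_neighbor_def X_def)
  qed (use assms fin in auto)
  show ?thesis
  proof (rule completed_sets_eqI[OF occupation_events_subset])
    show "exchangeable_events X \<subseteq> sets P"
      unfolding sets_P by (auto simp: exchangeable_events_def)
  qed (rule exchangeable_AE_occupation)
qed

end
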